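(* Let $X\in\mathbb{R}^{m\times n}$ with $m\ge n$ satisfy $$6n^2\mathbf{u}\,\kappa_2(X)<1,\qquad mn\mathbf{u}\le\tfrac1{64},\qquad n(n+1)\mathbf{u}\le\tfrac1{64},$$ and $$\kappa_2(X)\le\frac{\mathbf{u}^{-1}}{96\{mn+n(n+1)\}} .$$ Then the algorithm shiftedCholeskyQR3, run in floating-point arithmetic, computes a QR factorization $X\approx\hat Q\hat R$ satisfying the orthogonality measure $$\|\hat Q^{\top}\hat Q-I\|_F\le 6\{mn+n(n+1)\}\mathbf{u}$$ and the backward error bound $$\frac{\|\hat Q\hat R-X\|_F}{\|X\|_2}\le 15n^2\mathbf{u}.$$
   Context: $\mathbf{u}$ is the unit roundoff, and $\gamma_k:=\frac{k\mathbf{u}}{1-k\mathbf{u}}$. $|M|$ is the matrix of absolute values of the entries of $M$, and inequalities between matrices are entrywise. $\|\cdot\|_2$, $\|\cdot\|_F$ are the spectral and Frobenius norms; $\kappa_2(X)=\|X\|_2/\sigma_n(X)$ with $\sigma_n(X)$ the smallest singular value. $\mathrm{chol}(H)$ denotes the upper triangular Cholesky factor $R$ with $R^{\top}R=H$. Algorithm shiftedCholeskyQR3 for $X$ (one shifted Cholesky QR step followed by CholeskyQR2, i.e. two unshifted Cholesky QR steps): 1. $Q:=X$; $A:=Q^{\top}Q$; $s:=11\{mn+n(n+1)\}\mathbf{u}\|X\|_2^2$; $R:=\mathrm{chol}(A+sI)$; $Q:=QR^{-1}$. 2. $\tilde R:=\mathrm{chol}(Q^{\top}Q)$, $Q:=Q\tilde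 R^{-1}$, $R:=\tilde RR$. 3. $\tilde R:=\mathrm{chol}(Q^{\top}Q)$, $Q:=Q\tilde R^{-1}$, $R:=\tilde RR$. The output is the final $Q,R$; the matrices $\hat Q,\hat R$ in the claim are the final computed ones, and $\hat Q\hat R$ is their exact product. Floating-point model: - A Gram matrix $Y^{\top}Y$ of an $m\times n$ matrix $Y$ is computed as a symmetric matrix $Y^{\top}Y+E_1$ with $|E_1|\le\gamma_m|Y|^{\top}|Y|$. - The computed Cholesky factor $\hat T$ of a symmetric $n\times n$ matrix $H$ (where $H$ is the computed Gram matrix, plus $sI$ in the shifted step) is upper triangular and nonsingular and satisfies $\hat T^{\top}\hat T=H+E_2$ with $|E_2|\le\gamma_{n+1}|\hat T|^{\top}|\hat T|$; the floating-point factorization runs to completion whenever $H$ is positive definite with $\lambda_{\min}(H)\ge\sum_{i=1}^n\frac{\gamma_{i+1}}{1-\gamma_{i+1}}\|H\|_2$. - $Y\hat T^{-1}$ is computed row by row by triangular solves: the $i$th computed row $\hat z_i^{\top}$ satisfies $\hat z_i^{\top}(\hat T+\Delta\hat T_i)=y_i^{\top}$ with $|\Delta\hat T_i|\le\gamma_n|\hat T|$, where $y_i^{\top}$ is the $i$th row of $Y$. - A product $ST$ of $n\times n$ matrices is computed with error bounded entrywise by $\gamma_n|S||T|$. *)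

theory Defs
  imports "HOL-Analysis.Analysis" "HOL-Library.Monad_Syntax"
begin

text \<open>
  An \<open>m\<close> by \<open>n\<close> matrix has type \<^typ>\<open>real^'n^'m\<close>. The library's \<open>\<bar>M\<bar>\<close> and \<open>M \<le> N\<close> are entrywise on this
  type. The column index type carries a linear order, so that triangularity makes sense; the synonym
  below is there because \<open>real^'n^'m\<close> forces the sort of \<open>'n\<close> to be just \<open>finite\<close>.
\<close>

type_synonym ('m, 'n) rmat = "real^'n^'m"

definition upper_triangular :: "('n::{finite,linorder}, 'n) rmat \<Rightarrow> bool" where
  "upper_triangular A \<longleftrightarrow> (\<forall>i j. j < i \<longrightarrow> A $ i $ j = 0)"

definition symmetric_matrix :: "real^'n^'n \<Rightarrow> bool" where
  "symmetric_matrix A \<longleftrightarrow> transpose A = A"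

definition positive_definite :: "real^'n^'n \<Rightarrow> bool" where
  "positive_definite A \<longleftrightarrow> symmetric_matrix A \<and> (\<forall>v. v \<noteq> 0 \<longrightarrow> v \<bullet> (A *v v) > 0)"

definition eigenvalue :: "real^'n^'n \<Rightarrow> real \<Rightarrow> bool" where
  "eigenvalue A l \<longleftrightarrow> (\<exists>v. v \<noteq> 0 \<and> A *v v = l *\<^sub>R v)"

definition lambda_min :: "real^'n^'n \<Rightarrow> real" where
  "lambda_min A = (LEAST l. eigenvalue A l)"

definition spectral_norm :: "real^'n^'m \<Rightarrow> real" where
  "spectral_norm A = onorm (\<lambda>v. A *v v)"

definition frobenius_norm :: "real^'n^'m \<Rightarrow> real" where
  "frobenius_norm A = sqrt (\<Sum>i\<in>UNIV. \<Sum>j\<in>UNIV. (A $ i $ j)\<^sup>2)"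

text \<open>
  The square roots of the eigenvalues of \<open>A\<^sup>T A\<close> are the \<open>n\<close> singular values of \<open>A\<close> when \<open>m \<ge> n\<close>,
  which is the only case in which the following definitions are used.
\<close>

definition sigma_min :: "real^'n^'m \<Rightarrow> real" where
  "sigma_min A = (LEAST s. 0 \<le> s \<and> eigenvalue (transpose A ** A) (s\<^sup>2))"

text \<open>
  The condition number is infinite for rank-deficient matrices; real division would make it 0.
\<close>

definition kappa2 :: "real^'n^'m \<Rightarrow> ereal" where
  "kappa2 A = (if sigma_min A = 0 then \<infinity> else ereal (spectral_norm A / sigma_min A))"

definition gamma :: "real \<Rightarrow> nat \<Rightarrow> real" where
  "gamma u k = real k * u / (1 - real k * u)"

text \<open>
  Floating-point kernels, abstracted to their rounding error bounds: \<open>gram Y\<close> is the computed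
  \<open>Y\<^sup>T Y\<close>, \<open>chol H\<close> the computed Cholesky factor of \<open>H\<close> (\<^const>\<open>None\<close> if the factorization breaks
  down), \<open>trsolve Y T\<close> the computed \<open>Y T\<^sup>-\<^sup>1\<close>, and \<open>mult S T\<close> the computed \<open>S T\<close>.
  The index types give the dimensions \<open>m = CARD('m)\<close> and \<open>n = CARD('n)\<close>.
\<close>

locale fp_arithmetic =
  fixes u :: real
    and gram :: "('m::finite, 'n::{finite,linorder}) rmat \<Rightarrow> ('n, 'n) rmat"
    and chol :: "('n, 'n) rmat \<Rightarrow> ('n, 'n) rmat option"
    and trsolve :: "('m, 'n) rmat \<Rightarrow> ('n, 'n) rmat \<Rightarrow> ('m, 'n) rmat"
    and mult :: "('n, 'n) rmat \<Rightarrow> ('n, 'n) rmat \<Rightarrow> ('n, 'n) rmat"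
  assumes u_pos: "0 < u"
    and gram_symmetric: "\<And>Y. symmetric_matrix (gram Y)"
    and gram_error:
      "\<And>Y. \<exists>E. gram Y = transpose Y ** Y + E
            \<and> \<bar>E\<bar> \<le> gamma u CARD('m) *\<^sub>R (transpose \<bar>Y\<bar> ** \<bar>Y\<bar>)"
    and chol_factor:
      "\<And>H T. symmetric_matrix H \<Longrightarrow> chol H = Some T \<Longrightarrow> upper_triangular T \<and> invertible T"
    and chol_error:
      "\<And>H T. symmetric_matrix H \<Longrightarrow> chol H = Some T \<Longrightarrow>
         \<exists>E. transpose T ** T = H + E
            \<and> \<bar>E\<bar> \<le> gamma u (CARD('n) + 1) *\<^sub>R (transpose \<bar>T\<bar> ** \<bar>T\<bar>)"
    and chol_completes:
      "\<And>H. positive_definite H \<Longrightarrow>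
         lambda_min H \<ge>
           (\<Sum>i = 1..CARD('n). gamma u (i + 1) / (1 - gamma u (i + 1)) * spectral_norm H) \<Longrightarrow>
         \<exists>T. chol H = Some T"
    and trsolve_error:
      "\<And>Y T i. upper_triangular T \<Longrightarrow> invertible T \<Longrightarrow>
         \<exists>D. (trsolve Y T $ i) v* (T + D) = Y $ i \<and> \<bar>D\<bar> \<le> gamma u CARD('n) *\<^sub>R \<bar>T\<bar>"
    and mult_error:
      "\<And>S T. \<bar>mult S T - S ** T\<bar> \<le> gamma u CARD('n) *\<^sub>R (\<bar>S\<bar> ** \<bar>T\<bar>)"
begin

definition shift :: "('m, 'n) rmat \<Rightarrow> real" where
  "shift X = (let m = real CARD('m); n = real CARD('n) in
     11 * (m * n + n * (n + 1)) * u * (spectral_norm X)\<^sup>2)"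

definition cholesky_qr_step ::
    "('m, 'n) rmat \<times> ('n, 'n) rmat \<Rightarrow> (('m, 'n) rmat \<times> ('n, 'n) rmat) option" where
  "cholesky_qr_step = (\<lambda>(Q, R). do {
     R' \<leftarrow> chol (gram Q);
     Some (trsolve Q R', mult R' R)
   })"

text \<open>\<open>mat s\<close> is \<open>s I\<close>.\<close>

definition shiftedCholeskyQR3 ::
    "('m, 'n) rmat \<Rightarrow> (('m, 'n) rmat \<times> ('n, 'n) rmat) option" where
  "shiftedCholeskyQR3 X = do {
     R \<leftarrow> chol (gram X + mat (shift X));
     QR \<leftarrow> cholesky_qr_step (trsolve X R, R);
     cholesky_qr_step QR
   }"

end

end

theory Submission
  imports Defs
begin

text \<open>
  Write \<open>eps = (m n + n (n + 1)) u\<close>. Since \<open>\<kappa>\<^sub>2 X \<ge> 1\<close>, the bound \<open>\<kappa>\<^sub>2 X \<le> 1 / (96 eps)\<close> forces \<open>eps \<le> 1/96\<close>, so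
  all the constants \<open>\<gamma>\<^sub>k\<close> are at most slightly larger than \<open>k u\<close>.

  One (possibly shifted) Cholesky QR step is analysed once, for a matrix \<open>Y\<close> and a shift \<open>s\<close>. Let
  \<open>\<mu>\<^sup>2\<close> bound \<open>\<parallel>Y\<parallel>\<^sup>2 + s\<close> from above and \<open>\<lambda>\<^sup>2\<close> bound the spectrum of \<open>Y\<^sup>T Y + s I\<close> from below. The
  computed factor satisfies \<open>T\<^sup>T T = Y\<^sup>T Y + s I + E\<close> with \<open>E\<close> of size \<open>eps \<mu>\<^sup>2\<close>: the Gram matrix
  contributes \<open>m n u \<mu>\<^sup>2\<close> and the factorization \<open>n (n + 1) u \<mu>\<^sup>2\<close>. If \<open>9 eps \<mu>\<^sup>2 \<le> \<lambda>\<^sup>2\<close>, then \<open>E\<close> cannot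
  destroy definiteness, the factorization completes and \<open>T\<close> has condition number at most about
  \<open>\<mu> / \<lambda>\<close> (\<open>cholesky_of_gram\<close>). The row-wise solves give \<open>Z = Y T\<^sup>-\<^sup>1 + F\<close> with \<open>F\<close> of size \<open>eps \<mu> / \<lambda>\<close>
  and \<open>Z T = Y\<close> up to \<open>n\<^sup>2 u \<mu>\<close> (\<open>triangular_solve\<close>, \<open>cholesky_qr_bounds\<close>). Without a shift,
  \<open>Z\<^sup>T Z = I\<close> up to errors of size \<open>eps (\<mu> / \<lambda>)\<^sup>2\<close> and \<open>eps \<mu> / \<lambda>\<close> (\<open>cholesky_qr_orthogonality\<close>).

  This analysis is applied three times. In the shifted step the shift alone supplies \<open>\<lambda>\<^sup>2\<close>, so the step
  succeeds however small \<open>\<sigma>\<^sub>n X\<close> is; the bound on \<open>\<kappa>\<^sub>2 X\<close> then shows that its result has norm at most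
  \<open>1.1\<close> and smallest singular value at least \<open>8 \<surd>eps\<close>. For the second step \<open>eps (\<mu> / \<lambda>)\<^sup>2\<close> is therefore
  a small constant and its result has all its singular values within \<open>2.5%\<close> of \<open>1\<close>. For the third
  step \<open>\<mu> / \<lambda>\<close> is close to \<open>1\<close>, so its loss of orthogonality is less than \<open>3 eps\<close>.

  The backward error telescopes: the residuals of the three solves and the rounding errors of the two
  products of triangular factors enter \<open>Q R - X\<close> only after multiplication by matrices whose norms are
  bounded by small constants, or by such a constant times \<open>\<parallel>X\<parallel>\<close> for the triangular factors of \<open>X\<close>
  (\<open>product_residual_le\<close>).
\<close>

section \<open>Spectral and Frobenius norms\<close>

text \<open>
  On the type of matrices, which are vectors of rows, the Euclidean norm is the Frobenius
  norm. Working with \<^const>\<open>norm\<close> makes the general facts on normed spaces available.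
\<close>

lemma frobenius_norm_eq_norm: "frobenius_norm A = norm A"
  by (simp add: frobenius_norm_def norm_vec_def L2_set_def sum_nonneg)

lemma norm_matrix_sq_rows: "(norm (A :: real^'n^'m))\<^sup>2 = (\<Sum>i\<in>UNIV. (norm (A $ i))\<^sup>2)"
  by (simp add: norm_vec_def L2_set_def sum_nonneg)

lemma norm_transpose: "norm (transpose A) = norm (A :: real^'n^'m)"
proof -
  have "(\<Sum>i\<in>UNIV. \<Sum>j\<in>UNIV. (transpose A $ i $ j)\<^sup>2) = (\<Sum>i\<in>UNIV. \<Sum>j\<in>UNIV. (A $ i $ j)\<^sup>2)"
    by (subst sum.swap) (simp add: transpose_def)
  then show ?thesis
    by (simp add: frobenius_norm_eq_norm[symmetric] frobenius_norm_def)
qed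

lemma norm_matrix_abs: "norm \<bar>A\<bar> = norm (A :: real^'n^'m)"
  by (simp add: frobenius_norm_eq_norm[symmetric] frobenius_norm_def abs_vec_def)

lemma norm_matrix_mono:
  fixes A B :: "real^'n^'m"
  assumes "\<bar>A\<bar> \<le> B"
  shows "norm A \<le> norm B"
proof -
  have "(A $ i $ j)\<^sup>2 \<le> (B $ i $ j)\<^sup>2" for i j
    using assms by (simp add: less_eq_vec_def abs_vec_def abs_le_square_iff[symmetric])
      (meson abs_ge_self order_trans)
  then show ?thesis
    unfolding frobenius_norm_eq_norm[symmetric] frobenius_norm_def
    by (intro real_sqrt_le_mono sum_mono)
qed

lemma norm_vector_le_spectral_norm: "norm (A *v x) \<le> spectral_norm A * norm x"
  unfolding spectral_norm_def by (rule onorm) simp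

lemma spectral_norm_nonneg: "0 \<le> spectral_norm A"
  unfolding spectral_norm_def by (rule onorm_pos_le) simp

lemma spectral_norm_le: "(\<And>x. norm (A *v x) \<le> c * norm x) \<Longrightarrow> spectral_norm A \<le> c"
  unfolding spectral_norm_def by (rule onorm_le)

lemma spectral_norm_add_le: "spectral_norm (A + B) \<le> spectral_norm A + spectral_norm B"
proof (rule spectral_norm_le)
  fix x
  have "norm ((A + B) *v x) \<le> norm (A *v x) + norm (B *v x)"
    by (simp add: matrix_vector_mult_add_rdistrib norm_triangle_ineq)
  then show "norm ((A + B) *v x) \<le> (spectral_norm A + spectral_norm B) * norm x"
    using norm_vector_le_spectral_norm[of A x] norm_vector_le_spectral_norm[of B x]
    by (simp add: algebra_simps)
qed

lemma spectral_norm_mult_le: "spectral_norm (A ** B) \<le> spectral_norm A * spectral_norm B"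
proof (rule spectral_norm_le)
  fix x
  have "norm ((A ** B) *v x) \<le> spectral_norm A * norm (B *v x)"
    by (simp add: matrix_vector_mul_assoc[symmetric] norm_vector_le_spectral_norm)
  also have "\<dots> \<le> spectral_norm A * (spectral_norm B * norm x)"
    by (intro mult_left_mono norm_vector_le_spectral_norm spectral_norm_nonneg)
  finally show "norm ((A ** B) *v x) \<le> spectral_norm A * spectral_norm B * norm x"
    by (simp add: mult.assoc)
qed

lemma norm_transpose_vector_le: "norm (transpose A *v x) \<le> spectral_norm A * norm x"
proof -
  have "(norm (transpose A *v x))\<^sup>2 = x \<bullet> (A *v (transpose A *v x))"
    by (simp add: power2_norm_eq_inner dot_lmul_matrix)
  also have "\<dots> \<le> norm x * (spectral_norm A * norm (transpose A *v x))"
    by (intro order_trans[OF norm_cauchy_schwarz] mult_left_mono norm_vector_le_spectral_norm) simp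
  finally have "norm (transpose A *v x) * norm (transpose A *v x)
      \<le> (spectral_norm A * norm x) * norm (transpose A *v x)"
    by (simp add: power2_eq_square mult_ac)
  then show ?thesis
    using mult_right_le_imp_le[of _ "norm (transpose A *v x)"]
    by (cases "norm (transpose A *v x) = 0") (auto simp: spectral_norm_nonneg simp del: transpose_matrix_vector)
qed

lemma spectral_norm_transpose: "spectral_norm (transpose A) = spectral_norm A"
  using norm_transpose_vector_le[of A] norm_transpose_vector_le[of "transpose A"]
  by (intro antisym spectral_norm_le) (auto simp del: transpose_matrix_vector)

lemma norm_matrix_mult_le_right:
  "norm (A ** B) \<le> norm (A :: real^'n^'m) * spectral_norm (B :: real^'k^'n)"
proof -
  have "(norm ((A ** B) $ i))\<^sup>2 \<le> (norm (A $ i))\<^sup>2 * (spectral_norm B)\<^sup>2" for i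
  proof -
    have "(A ** B) $ i = transpose B *v (A $ i)"
      by (simp add: matrix_matrix_mult_def vector_matrix_mult_def vec_eq_iff)
    then have "norm ((A ** B) $ i) \<le> spectral_norm B * norm (A $ i)"
      using norm_transpose_vector_le by metis
    then show ?thesis
      by (metis mult.commute norm_ge_zero power_mono power_mult_distrib)
  qed
  then have "(norm (A ** B))\<^sup>2 \<le> (norm A * spectral_norm B)\<^sup>2"
    by (simp add: norm_matrix_sq_rows power_mult_distrib sum_distrib_right sum_mono)
  then show ?thesis
    by (rule power2_le_imp_le) (simp add: spectral_norm_nonneg)
qed

lemma norm_matrix_mult_le_left:
  "norm (A ** B) \<le> spectral_norm (A :: real^'n^'m) * norm (B :: real^'k^'n)"
  using norm_matrix_mult_le_right[of "transpose B" "transpose A"]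
  by (metis matrix_transpose_mul mult.commute norm_transpose spectral_norm_transpose)

lemma spectral_norm_le_norm: "spectral_norm A \<le> norm (A :: real^'n^'m)"
proof (rule spectral_norm_le)
  fix x
  have "\<bar>(A *v x) $ i\<bar> \<le> norm (A $ i) * norm x" for i
    by (simp add: matrix_vector_mul_component Cauchy_Schwarz_ineq2)
  then have "((A *v x) $ i)\<^sup>2 \<le> (norm (A $ i))\<^sup>2 * (norm x)\<^sup>2" for i
    by (metis abs_le_square_iff abs_mult abs_norm_cancel power_mult_distrib)
  then have "(norm (A *v x))\<^sup>2 \<le> (norm A * norm x)\<^sup>2"
    by (simp add: norm_matrix_sq_rows power_mult_distrib sum_distrib_right
        norm_vec_def[of "A *v x"] L2_set_def sum_nonneg sum_mono)
  then show "norm (A *v x) \<le> norm A * norm x"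
    by (rule power2_le_imp_le) simp
qed

lemma norm_matrix_mult_le: "norm (A ** B) \<le> norm (A :: real^'n^'m) * norm (B :: real^'k^'n)"
  by (rule order_trans[OF norm_matrix_mult_le_right]) (simp add: mult_left_mono spectral_norm_le_norm)

lemma norm_mat_1: "norm (mat 1 :: real^'n^'n) = sqrt (real CARD('n))"
proof -
  have "(norm ((mat 1 :: real^'n^'n) $ i))\<^sup>2 = 1" for i
    by (simp add: mat_def power2_norm_eq_inner inner_vec_def if_distrib cong: if_cong)
  then have "(norm (mat 1 :: real^'n^'n))\<^sup>2 = real CARD('n)"
    by (simp add: norm_matrix_sq_rows)
  then show ?thesis
    by (metis norm_ge_zero real_sqrt_unique)
qed

lemma norm_le_sqrt_spectral_norm:
  "norm (A :: real^'n^'m) \<le> sqrt (real CARD('n)) * spectral_norm A"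
  using norm_matrix_mult_le_left[of A "mat 1"] by (simp add: norm_mat_1 mult.commute)

text \<open>
  The componentwise errors of the Gram matrix and of the factorization become normwise errors through
  this estimate: taking absolute values keeps the Frobenius norm, and the passage to the spectral norm
  costs the factor \<open>\<surd>n\<close> twice.
\<close>

lemma norm_abs_gram_le:
  fixes A :: "real^'n^'m"
  shows "norm (transpose \<bar>A\<bar> ** \<bar>A\<bar>) \<le> real CARD('n) * (spectral_norm A)\<^sup>2"
proof -
  have "norm (transpose \<bar>A\<bar> ** \<bar>A\<bar>) \<le> norm (transpose \<bar>A\<bar>) * norm \<bar>A\<bar>"
    by (rule norm_matrix_mult_le)
  also have "\<dots> = norm A * norm A"
    by (simp only: norm_transpose norm_matrix_abs)
  also have "\<dots> \<le> (sqrt (real CARD('n)) * spectral_norm A) * (sqrt (real CARD('n)) * spectral_norm A)"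
    by (intro mult_mono norm_le_sqrt_spectral_norm) (auto simp: spectral_norm_nonneg)
  also have "\<dots> = real CARD('n) * (spectral_norm A)\<^sup>2"
    by (simp add: power2_eq_square)
  finally show ?thesis .
qed

lemma norm_abs_mult_le:
  fixes A :: "real^'n^'m" and B :: "real^'k^'n"
  shows "norm (\<bar>A\<bar> ** \<bar>B\<bar>) \<le> norm A * norm B"
  using norm_matrix_mult_le[of "\<bar>A\<bar>" "\<bar>B\<bar>"] by (simp only: norm_matrix_abs)

lemma abs_inner_mult_le: "\<bar>v \<bullet> (E *v v)\<bar> \<le> norm (E :: real^'n^'n) * (norm v)\<^sup>2"
proof -
  have "\<bar>v \<bullet> (E *v v)\<bar> \<le> norm v * norm (E *v v)"
    by (rule Cauchy_Schwarz_ineq2)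
  also have "\<dots> \<le> norm v * (norm E * norm v)"
    by (intro mult_left_mono order_trans[OF norm_vector_le_spectral_norm] mult_right_mono
        spectral_norm_le_norm) auto
  finally show ?thesis by (simp add: power2_eq_square mult_ac)
qed

lemma transpose_add: "transpose (A + B) = transpose A + transpose (B :: real^'n^'m)"
  by (simp add: transpose_def vec_eq_iff)

lemma mat_0: "mat 0 = (0 :: real^'n^'n)"
  by (simp add: mat_def vec_eq_iff)

lemma matrix_add_rdistrib: "(A + B) ** C = A ** C + B ** (C :: real^'k^'n)"
  by (simp add: matrix_matrix_mult_def vec_eq_iff distrib_right sum.distrib)

lemma matrix_diff_rdistrib: "(A - B) ** C = A ** C - B ** (C :: real^'k^'n)"
  by (simp add: matrix_matrix_mult_def vec_eq_iff left_diff_distrib sum_subtractf)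

lemma upper_triangular_product_entry_eq_0:
  assumes "upper_triangular S" "upper_triangular T" "j < i"
  shows "(S ** T) $ i $ j = 0"
proof -
  have "S $ i $ k * T $ k $ j = 0" for k
    using assms unfolding upper_triangular_def by (cases "k < i") auto
  then have "(\<Sum>k\<in>UNIV. S $ i $ k * T $ k $ j) = 0" by (intro sum.neutral) blast
  then show ?thesis by (simp add: matrix_matrix_mult_def)
qed

section \<open>Least eigenvalues and Rayleigh quotients\<close>

lemma mat_mult_vector: "mat s *v x = s *\<^sub>R (x :: real^'n)"
  by (simp add: vec_eq_iff matrix_vector_mult_def mat_def if_distrib if_distribR cong: if_cong)

lemma inner_transpose: "x \<bullet> (transpose A *v y) = (A *v x) \<bullet> y" for A :: "real^'n^'m"
  using dot_lmul_matrix[of y A x] by (simp add: inner_commute)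

lemma inner_gram: "x \<bullet> ((transpose A ** A) *v x) = (norm (A *v x))\<^sup>2" for A :: "real^'n^'m"
  using inner_transpose[of x A "A *v x"]
  by (simp only: matrix_vector_mul_assoc power2_norm_eq_inner)

text \<open>
  With \<open>r = H w - l w\<close>, the quadratic form of \<open>H - l I\<close> at \<open>w + t r\<close> is \<open>2 t (r \<bullet> r) + O(t\<^sup>2)\<close>. It is never
  negative, so the linear coefficient vanishes and hence \<open>r = 0\<close>.
\<close>

lemma rayleigh_minimizer_eigenvector:
  fixes H :: "real^'n^'n"
  assumes sym: "symmetric_matrix H"
    and min: "\<And>v. l * (norm v)\<^sup>2 \<le> v \<bullet> (H *v v)"
    and eq: "w \<bullet> (H *v w) = l * (norm w)\<^sup>2"
  shows "H *v w = l *\<^sub>R w"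
proof -
  define r where "r = H *v w - l *\<^sub>R w"
  have sw: "x \<bullet> (H *v y) = y \<bullet> (H *v x)" for x y
    using inner_transpose[of x H y] sym by (simp only: symmetric_matrix_def inner_commute)
  define c where "c = r \<bullet> (H *v r) - l * (norm r)\<^sup>2"
  have nonneg: "0 \<le> 2 * t * (r \<bullet> r) + t\<^sup>2 * c" for t
  proof -
    have "(w + t *\<^sub>R r) \<bullet> (H *v (w + t *\<^sub>R r)) - l * (norm (w + t *\<^sub>R r))\<^sup>2
        = (w \<bullet> (H *v w) - l * (norm w)\<^sup>2) + 2 * t * (r \<bullet> (H *v w) - l * (r \<bullet> w)) + t\<^sup>2 * c"
      unfolding c_def power2_norm_eq_inner
      by (simp add: sw[of w r] inner_commute[of w r] matrix_vector_right_distrib matrix_vector_mult_scaleR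
          inner_add_left inner_add_right algebra_simps power2_eq_square)
    also have "r \<bullet> (H *v w) - l * (r \<bullet> w) = r \<bullet> r"
      by (simp add: r_def inner_diff_right)
    finally show ?thesis
      using min[of "w + t *\<^sub>R r"] eq by simp
  qed
  have "r \<bullet> r = 0"
  proof (rule ccontr)
    assume "r \<bullet> r \<noteq> 0"
    then have pos: "0 < r \<bullet> r" by (simp add: inner_ge_zero less_le)
    have "0 \<le> c"
      using min[of r] by (simp add: c_def)
    \<comment> \<open>A negative \<open>t\<close> so small that the linear term dominates; the \<open>+ 1\<close> covers \<open>c = 0\<close>.\<close>
    define t where "t = - (r \<bullet> r) / (c + 1)"
    have "2 * t * (r \<bullet> r) + t\<^sup>2 * c = t * (2 * (r \<bullet> r) + t * c)"
      by (simp add: algebra_simps power2_eq_square)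
    moreover have "t < 0" using pos \<open>0 \<le> c\<close> by (simp add: t_def field_simps)
    moreover have "t * c > - (r \<bullet> r)" using pos \<open>0 \<le> c\<close> by (simp add: t_def field_simps)
    ultimately have "2 * t * (r \<bullet> r) + t\<^sup>2 * c < 0"
      using pos by (smt (verit, ccfv_SIG) mult_neg_pos)
    then show False using nonneg[of t] by simp
  qed
  then show ?thesis by (simp add: r_def)
qed

text \<open>
  By compactness the Rayleigh quotient attains its minimum on the unit sphere. In particular the least
  eigenvalue exists, which gives meaning to the definitions by \<^const>\<open>Least\<close>.
\<close>

lemma least_eigenvalue_exists:
  fixes H :: "real^'n^'n"
  assumes sym: "symmetric_matrix H"
  obtains l where "eigenvalue H l" "\<And>v. l * (norm v)\<^sup>2 \<le> v \<bullet> (H *v v)"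
proof -
  have "compact (sphere (0 :: real^'n) 1)" by simp
  moreover have "sphere (0 :: real^'n) 1 \<noteq> {}" by simp
  moreover have "continuous_on (sphere 0 1) (\<lambda>v. v \<bullet> (H *v v))"
    by (intro continuous_intros matrix_vector_mult_linear_continuous_on)
  ultimately obtain w where w: "w \<in> sphere 0 1"
    and least: "\<And>v. v \<in> sphere 0 1 \<Longrightarrow> w \<bullet> (H *v w) \<le> v \<bullet> (H *v v)"
    using continuous_attains_inf[of "sphere 0 1" "\<lambda>v. v \<bullet> (H *v v)"] by blast
  define l where "l = w \<bullet> (H *v w)"
  have ray: "l * (norm v)\<^sup>2 \<le> v \<bullet> (H *v v)" for v
  proof (cases "v = 0")
    case False
    have "l \<le> (inverse (norm v) *\<^sub>R v) \<bullet> (H *v (inverse (norm v) *\<^sub>R v))"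
      unfolding l_def by (rule least) (simp add: False)
    also have "\<dots> = (v \<bullet> (H *v v)) / (norm v)\<^sup>2"
      by (simp add: matrix_vector_mult_scaleR power2_eq_square field_simps)
    finally show ?thesis using False by (simp add: pos_le_divide_eq)
  qed simp
  have "H *v w = l *\<^sub>R w"
    using w by (intro rayleigh_minimizer_eigenvector[OF sym ray]) (simp add: l_def)
  then have "eigenvalue H l"
    using w unfolding eigenvalue_def by (intro exI[of _ w]) auto
  then show thesis using that ray by blast
qed

lemma eigenvalue_ge:
  assumes "\<And>v. l * (norm v)\<^sup>2 \<le> v \<bullet> (H *v v)" and "eigenvalue H k"
  shows "l \<le> k"
proof -
  obtain v where "v \<noteq> 0" "H *v v = k *\<^sub>R v"
    using assms(2) by (auto simp: eigenvalue_def)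
  then show ?thesis
    using assms(1)[of v] by (simp add: power2_norm_eq_inner)
qed

lemma lambda_min_ge:
  fixes H :: "real^'n^'n"
  assumes sym: "symmetric_matrix H" and ge: "\<And>v. c * (norm v)\<^sup>2 \<le> v \<bullet> (H *v v)"
  shows "c \<le> lambda_min H"
proof -
  obtain l where l: "eigenvalue H l" "\<And>v. l * (norm v)\<^sup>2 \<le> v \<bullet> (H *v v)"
    using least_eigenvalue_exists[OF sym] by blast
  have "lambda_min H = l"
    unfolding lambda_min_def using l eigenvalue_ge[OF l(2)] by (intro Least_equality) auto
  then show ?thesis using eigenvalue_ge[OF ge l(1)] by simp
qed

lemma symmetric_matrix_gram: "symmetric_matrix (transpose A ** A)"
  by (simp add: symmetric_matrix_def matrix_transpose_mul)

lemma sigma_min_nonneg: "0 \<le> sigma_min A"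
  and sigma_min_le: "sigma_min A * norm v \<le> norm (A *v v)"
proof -
  obtain l where l: "eigenvalue (transpose A ** A) l"
      "\<And>v. l * (norm v)\<^sup>2 \<le> v \<bullet> ((transpose A ** A) *v v)"
    using least_eigenvalue_exists[OF symmetric_matrix_gram] by blast
  have "0 \<le> l"
    by (rule eigenvalue_ge[OF _ l(1)]) (simp add: inner_gram del: transpose_matrix_vector)
  have "sigma_min A = sqrt l"
    unfolding sigma_min_def
  proof (rule Least_equality)
    show "0 \<le> sqrt l \<and> eigenvalue (transpose A ** A) ((sqrt l)\<^sup>2)"
      using l \<open>0 \<le> l\<close> by simp
    show "sqrt l \<le> s" if "0 \<le> s \<and> eigenvalue (transpose A ** A) (s\<^sup>2)" for s
      using eigenvalue_ge[OF l(2)] that by (metis real_le_lsqrt)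
  qed
  then show "0 \<le> sigma_min A" using \<open>0 \<le> l\<close> by simp
  have "(sqrt l * norm v)\<^sup>2 \<le> (norm (A *v v))\<^sup>2"
    using l(2)[of v] \<open>0 \<le> l\<close> by (simp add: inner_gram power_mult_distrib)
  then show "sigma_min A * norm v \<le> norm (A *v v)"
    unfolding \<open>sigma_min A = sqrt l\<close> by (rule power2_le_imp_le) simp
qed

lemma sigma_min_le_spectral_norm:
  fixes X :: "real^'n^'m"
  shows "sigma_min X \<le> spectral_norm X"
proof -
  have "sigma_min X * norm (axis undefined 1 :: real^'n) \<le> spectral_norm X * norm (axis undefined 1 :: real^'n)"
    using sigma_min_le[of X] norm_vector_le_spectral_norm[of X] order_trans by blast
  then show ?thesis by simp
qed

lemma invertible_inverse:
  fixes T :: "real^'n^'n"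
  assumes "invertible T"
    and low: "\<And>v. tau * norm v \<le> norm (T *v v)" and "0 < tau"
  obtains S where "T ** S = mat 1" "S ** T = mat 1" "spectral_norm S \<le> 1 / tau"
proof -
  obtain S where S: "T ** S = mat 1" "S ** T = mat 1"
    using assms(1) by (auto simp: invertible_def)
  have "spectral_norm S \<le> 1 / tau"
  proof (rule spectral_norm_le)
    fix x
    show "norm (S *v x) \<le> 1 / tau * norm x"
      using low[of "S *v x"] \<open>0 < tau\<close>
      by (simp add: matrix_vector_mul_assoc S field_simps)
  qed
  then show thesis using that S by blast
qed

lemma singular_values_near_1_if_gram_near_mat_1:
  fixes Z :: "real^'b^'a"
  assumes "norm (transpose Z ** Z - mat 1) \<le> d"
  shows "(1 - d) * (norm v)\<^sup>2 \<le> (norm (Z *v v))\<^sup>2" "(norm (Z *v v))\<^sup>2 \<le> (1 + d) * (norm v)\<^sup>2"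
proof -
  have "v \<bullet> ((transpose Z ** Z - mat 1) *v v) = (norm (Z *v v))\<^sup>2 - (norm v)\<^sup>2"
    by (simp add: matrix_vector_mult_diff_rdistrib inner_diff_right inner_gram power2_norm_eq_inner)
  moreover have "\<bar>v \<bullet> ((transpose Z ** Z - mat 1) *v v)\<bar> \<le> d * (norm v)\<^sup>2"
    by (rule order_trans[OF abs_inner_mult_le]) (intro mult_right_mono assms, simp)
  ultimately show "(1 - d) * (norm v)\<^sup>2 \<le> (norm (Z *v v))\<^sup>2" "(norm (Z *v v))\<^sup>2 \<le> (1 + d) * (norm v)\<^sup>2"
    by (simp_all add: algebra_simps)
qed

section \<open>Rounding error constants\<close>

text \<open>
  The constants come from \<open>1 / (1 - k u) \<le> 96/95 \<le> 51/50\<close> and, for the quotients in the condition under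
  which the factorization completes, from \<open>1 - \<gamma>\<^sub>k \<ge> 47/48\<close>.
\<close>

lemma gamma_bounds:
  assumes "0 < u" "real k * u \<le> 1 / 96"
  shows "0 \<le> gamma u k" "gamma u k \<le> 51 / 50 * (real k * u)"
    "gamma u k / (1 - gamma u k) \<le> 51 / 50 * (48 / 47) * (real k * u)"
proof -
  have *: "real k * u \<ge> 0" using assms by simp
  then show g: "0 \<le> gamma u k" using assms by (simp add: gamma_def)
  have "real k * u / (1 - real k * u) \<le> real k * u / (95 / 96)"
    using * assms by (intro divide_left_mono) auto
  then have g2: "gamma u k \<le> 96 / 95 * (real k * u)" by (simp add: gamma_def)
  then show g3: "gamma u k \<le> 51 / 50 * (real k * u)" using * by simp
  have "gamma u k / (1 - gamma u k) \<le> gamma u k / (47 / 48)"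
    using g g2 assms by (intro divide_left_mono) auto
  also have "\<dots> = 48 / 47 * gamma u k" by simp
  also have "\<dots> \<le> 48 / 47 * (51 / 50 * (real k * u))" using g3 by (intro mult_left_mono) auto
  finally show "gamma u k / (1 - gamma u k) \<le> 51 / 50 * (48 / 47) * (real k * u)"
    by (simp only: mult_ac)
qed

lemma sum_gamma_ratio_le:
  assumes "0 < u" "(real N + 1) * u \<le> 1 / 96"
  shows "(\<Sum>i=1..N. gamma u (i + 1) / (1 - gamma u (i + 1))) \<le> 21 / 20 * (real N * (real N + 1) * u)"
proof -
  have "gamma u (i + 1) / (1 - gamma u (i + 1)) \<le> 21 / 20 * ((real N + 1) * u)"
    if "i \<in> {1..N}" for i
  proof -
    have le: "real (i + 1) * u \<le> (real N + 1) * u"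
      using that assms by (intro mult_right_mono) auto
    have "real (i + 1) * u \<le> 1 / 96" using le assms(2) by linarith
    from gamma_bounds(3)[OF assms(1) this]
    have "gamma u (i + 1) / (1 - gamma u (i + 1)) \<le> 51 / 50 * (48 / 47) * (real (i + 1) * u)" .
    also have "\<dots> \<le> 21 / 20 * (real (i + 1) * u)"
      using assms(1) by (intro mult_right_mono) auto
    also have "\<dots> \<le> 21 / 20 * ((real N + 1) * u)" using le by (rule mult_left_mono) simp
    finally show ?thesis .
  qed
  from sum_bounded_above[of "{1..N}", OF this] show ?thesis by (simp add: mult_ac)
qed

text \<open>
  The three steps share the dimensions and the accuracy, whose smallness is expressed by the single
  bound on \<open>eps\<close>. How well the matrix at hand is conditioned differs from step to step and is
  therefore left to the individual lemmas.
\<close>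

locale small_roundoff = fp_arithmetic u gram chol trsolve mult
  for u :: real
    and gram :: "('m::finite, 'n::{finite,linorder}) rmat \<Rightarrow> ('n, 'n) rmat"
    and chol :: "('n, 'n) rmat \<Rightarrow> ('n, 'n) rmat option"
    and trsolve :: "('m, 'n) rmat \<Rightarrow> ('n, 'n) rmat \<Rightarrow> ('m, 'n) rmat"
    and mult :: "('n, 'n) rmat \<Rightarrow> ('n, 'n) rmat \<Rightarrow> ('n, 'n) rmat" +
  fixes m n eps :: real
  assumes m_eq: "m = real CARD('m)" and n_eq: "n = real CARD('n)"
    and eps_eq: "eps = (m * n + n * (n + 1)) * u"
    and n_le_m: "n \<le> m"
    and eps_le: "eps \<le> 1 / 96"
begin

lemma n_ge_1: "1 \<le> n"
  unfolding n_eq by (simp add: Suc_le_eq)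

lemma eps_parts: "eps = m * n * u + n * (n + 1) * u"
  by (simp add: eps_eq algebra_simps)

lemma mnu_pos: "0 < m * n * u" and nnu_pos: "0 < n * (n + 1) * u" and eps_pos: "0 < eps"
  using n_ge_1 n_le_m u_pos by (auto simp: eps_parts intro!: add_pos_pos mult_pos_pos)

lemma n2u_le: "n\<^sup>2 * u \<le> eps / 2"
proof -
  have "n * n * u \<le> m * n * u"
    using n_ge_1 n_le_m u_pos by (intro mult_right_mono) auto
  moreover have "n * n * u \<le> n * (n + 1) * u"
    using n_ge_1 u_pos by (intro mult_right_mono mult_left_mono) auto
  ultimately show ?thesis by (simp add: eps_parts power2_eq_square)
qed

lemma n2u_nonneg: "0 \<le> n\<^sup>2 * u"
  using u_pos by simp

lemma dim_times_u_le: "m * u \<le> 1 / 96" "(n + 1) * u \<le> 1 / 96" "n * u \<le> 1 / 96"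
proof -
  have "m * u \<le> n * (m * u)" using mult_right_mono[OF n_ge_1, of "m * u"] n_ge_1 n_le_m u_pos by simp
  moreover have "(n + 1) * u \<le> n * ((n + 1) * u)"
    using mult_right_mono[OF n_ge_1, of "(n + 1) * u"] n_ge_1 u_pos by simp
  moreover have "n * (m * u) = m * n * u" "n * ((n + 1) * u) = n * (n + 1) * u" by simp_all
  ultimately show "m * u \<le> 1 / 96" and *: "(n + 1) * u \<le> 1 / 96"
    using eps_parts eps_le mnu_pos nnu_pos by linarith+
  show "n * u \<le> 1 / 96" using * u_pos by (simp add: algebra_simps)
qed

lemma gamma_nonneg: "0 \<le> gamma u CARD('m)" "0 \<le> gamma u CARD('n)" "0 \<le> gamma u (CARD('n) + 1)"
  and gamma_m_le: "n * gamma u CARD('m) \<le> 51 / 50 * (m * n * u)"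
  and gamma_Suc_n_le: "n * gamma u (CARD('n) + 1) \<le> 51 / 50 * (n * (n + 1) * u)"
  and gamma_n_le: "n * gamma u CARD('n) \<le> 51 / 50 * (n\<^sup>2 * u)"
proof -
  have d: "real CARD('m) * u \<le> 1 / 96" "real CARD('n) * u \<le> 1 / 96" "real (CARD('n) + 1) * u \<le> 1 / 96"
    using dim_times_u_le by (simp_all add: m_eq n_eq add.commute)
  show "0 \<le> gamma u CARD('m)" "0 \<le> gamma u CARD('n)" "0 \<le> gamma u (CARD('n) + 1)"
    using gamma_bounds(1)[OF u_pos] d by blast+
  have "n * gamma u CARD('m) \<le> n * (51 / 50 * (m * u))"
    "n * gamma u (CARD('n) + 1) \<le> n * (51 / 50 * ((n + 1) * u))"
    "n * gamma u CARD('n) \<le> n * (51 / 50 * (n * u))"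
    using gamma_bounds(2)[OF u_pos d(1)] gamma_bounds(2)[OF u_pos d(2)] gamma_bounds(2)[OF u_pos d(3)]
      n_ge_1 by (intro mult_left_mono; simp add: m_eq n_eq add.commute)+
  then show "n * gamma u CARD('m) \<le> 51 / 50 * (m * n * u)"
    "n * gamma u (CARD('n) + 1) \<le> 51 / 50 * (n * (n + 1) * u)"
    "n * gamma u CARD('n) \<le> 51 / 50 * (n\<^sup>2 * u)"
    by (simp_all add: algebra_simps power2_eq_square)
qed

section \<open>One Cholesky QR step\<close>

text \<open>
  Here \<open>mu\<close> and \<open>lam\<close> are the square roots of an upper and a lower bound for the spectrum of \<open>Y\<^sup>T Y + s I\<close>.
  The factorization completes because its threshold for the least eigenvalue is about \<open>n (n + 1) u mu\<^sup>2\<close>,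
  which together with the Gram error \<open>m n u mu\<^sup>2\<close> stays well below \<open>9 eps mu\<^sup>2\<close>. The norm of \<open>T\<close> is
  bounded implicitly: the error of \<open>T\<^sup>T T\<close> is at most \<open>n \<gamma>\<^bsub>n+1\<^esub> \<parallel>T\<parallel>\<^sup>2\<close>, which is absorbed into the left-hand side.
\<close>

lemma cholesky_of_gram:
  assumes norm_le: "(spectral_norm Y)\<^sup>2 + s \<le> mu\<^sup>2" and "0 \<le> s" and "0 \<le> mu" and "0 < lam"
    and low: "\<And>v. lam\<^sup>2 * (norm v)\<^sup>2 \<le> (norm (Y *v v))\<^sup>2 + s * (norm v)\<^sup>2"
    and small: "9 * eps * mu\<^sup>2 \<le> lam\<^sup>2"
  obtains T E where "chol (gram Y + mat s) = Some T" "upper_triangular T" "invertible T"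
    "transpose T ** T = transpose Y ** Y + mat s + E" "norm E \<le> 21 / 20 * eps * mu\<^sup>2"
    "spectral_norm T \<le> 51 / 50 * mu" "\<forall>v. 15 / 16 * lam * norm v \<le> norm (T *v v)"
proof -
  define H where "H = gram Y + mat s"
  define K where "K = mu\<^sup>2"
  \<comment> \<open>Up to constants, \<open>a\<close> is the Gram error and \<open>b\<close> the factorization error.\<close>
  define a where "a = m * n * u * K"
  define b where "b = n * (n + 1) * u * K"
  have K: "0 \<le> K" by (simp add: K_def)
  have ab: "eps * K = a + b" by (simp add: a_def b_def eps_parts algebra_simps)
  have "0 \<le> a" "0 \<le> b"
    using mnu_pos nnu_pos K by (simp_all add: a_def b_def)
  have "eps * K \<le> 1 / 96 * K" using eps_le K by (rule mult_right_mono)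
  then have abK: "a + b \<le> K / 96" by (simp add: ab)
  have lamab: "9 * a + 9 * b \<le> lam\<^sup>2" using small ab by (simp add: K_def)
  have "0 < lam\<^sup>2" using \<open>0 < lam\<close> by simp
  have symH: "symmetric_matrix H"
    using gram_symmetric[of Y] by (simp add: H_def symmetric_matrix_def transpose_add)
  obtain E1 where E1: "gram Y = transpose Y ** Y + E1"
    "\<bar>E1\<bar> \<le> gamma u CARD('m) *\<^sub>R (transpose \<bar>Y\<bar> ** \<bar>Y\<bar>)"
    using gram_error by blast
  have "norm E1 \<le> gamma u CARD('m) * norm (transpose \<bar>Y\<bar> ** \<bar>Y\<bar>)"
    using norm_matrix_mono[OF E1(2)] gamma_nonneg by simp
  also have "\<dots> \<le> gamma u CARD('m) * (n * (spectral_norm Y)\<^sup>2)"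
    unfolding n_eq by (intro mult_left_mono norm_abs_gram_le gamma_nonneg)
  also have "\<dots> \<le> gamma u CARD('m) * (n * K)"
    using norm_le \<open>0 \<le> s\<close> n_ge_1 by (intro mult_left_mono gamma_nonneg) (auto simp: K_def)
  also have "\<dots> = (n * gamma u CARD('m)) * K" by simp
  also have "\<dots> \<le> 51 / 50 * (m * n * u) * K" by (intro mult_right_mono gamma_m_le K)
  finally have nE1: "norm E1 \<le> 51 / 50 * a" by (simp add: a_def)
  have form: "v \<bullet> (H *v v) = (norm (Y *v v))\<^sup>2 + s * (norm v)\<^sup>2 + v \<bullet> (E1 *v v)" for v
    by (simp add: H_def E1(1) matrix_vector_mult_add_rdistrib inner_add_right inner_gram
        mat_mult_vector power2_norm_eq_inner)
  have lowH: "(lam\<^sup>2 - 51 / 50 * a) * (norm v)\<^sup>2 \<le> v \<bullet> (H *v v)" for v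
  proof -
    have "\<bar>v \<bullet> (E1 *v v)\<bar> \<le> 51 / 50 * a * (norm v)\<^sup>2"
      by (rule order_trans[OF abs_inner_mult_le]) (intro mult_right_mono nE1, simp)
    then show ?thesis unfolding form using low[of v] by (simp add: algebra_simps)
  qed
  have "spectral_norm H \<le> spectral_norm (transpose Y ** Y) + spectral_norm E1 + spectral_norm (mat s :: ('n, 'n) rmat)"
    unfolding H_def E1(1) using spectral_norm_add_le[of "transpose Y ** Y + E1" "mat s"]
      spectral_norm_add_le[of "transpose Y ** Y" E1] by linarith
  moreover have "spectral_norm (transpose Y ** Y) \<le> (spectral_norm Y)\<^sup>2"
    using spectral_norm_mult_le[of "transpose Y" Y] by (simp add: spectral_norm_transpose power2_eq_square)
  moreover have "spectral_norm (mat s :: ('n, 'n) rmat) \<le> s"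
    by (rule spectral_norm_le) (simp add: mat_mult_vector \<open>0 \<le> s\<close>)
  ultimately have nH: "spectral_norm H \<le> K + 51 / 50 * a"
    using spectral_norm_le_norm[of E1] nE1 norm_le unfolding K_def by linarith
  have posH: "positive_definite H"
    unfolding positive_definite_def
  proof (intro conjI allI impI symH)
    fix v :: "(real, 'n) vec" assume "v \<noteq> 0"
    have "51 / 50 * a \<le> lam\<^sup>2 / 2" using lamab \<open>0 \<le> a\<close> \<open>0 \<le> b\<close> by linarith
    then have "0 < lam\<^sup>2 - 51 / 50 * a" using \<open>0 < lam\<^sup>2\<close> by linarith
    then have "0 < (lam\<^sup>2 - 51 / 50 * a) * (norm v)\<^sup>2" using \<open>v \<noteq> 0\<close> by simp
    then show "0 < v \<bullet> (H *v v)" using lowH[of v] by linarith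
  qed
  have "(\<Sum>i = 1..CARD('n). gamma u (i + 1) / (1 - gamma u (i + 1)) * spectral_norm H)
      = (\<Sum>i = 1..CARD('n). gamma u (i + 1) / (1 - gamma u (i + 1))) * spectral_norm H"
    by (rule sum_distrib_right[symmetric])
  also have "\<dots> \<le> 21 / 20 * (n * (n + 1) * u) * spectral_norm H"
    using sum_gamma_ratio_le[OF u_pos, of "CARD('n)"] dim_times_u_le(2)
    by (intro mult_right_mono spectral_norm_nonneg) (simp add: n_eq)
  also have "\<dots> \<le> 21 / 20 * (n * (n + 1) * u) * (2 * K)"
    using nH abK \<open>0 \<le> a\<close> \<open>0 \<le> b\<close> nnu_pos K by (intro mult_left_mono) linarith+
  also have "\<dots> = 21 / 10 * b" by (simp add: b_def)
  also have "\<dots> \<le> lam\<^sup>2 - 51 / 50 * a" using lamab \<open>0 \<le> a\<close> \<open>0 \<le> b\<close> by linarith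
  also have "\<dots> \<le> lambda_min H" by (rule lambda_min_ge[OF symH lowH])
  finally obtain T where T: "chol H = Some T" using chol_completes[OF posH] by blast
  then have UT: "upper_triangular T" and IT: "invertible T" using chol_factor[OF symH] by auto
  obtain E2 where E2: "transpose T ** T = H + E2"
    "\<bar>E2\<bar> \<le> gamma u (CARD('n) + 1) *\<^sub>R (transpose \<bar>T\<bar> ** \<bar>T\<bar>)"
    using chol_error[OF symH T] by blast
  \<comment> \<open>The bound on the second error involves \<open>t\<close> itself, with a coefficient below \<open>1/90\<close>.\<close>
  define t where "t = (spectral_norm T)\<^sup>2"
  have "norm E2 \<le> gamma u (CARD('n) + 1) * norm (transpose \<bar>T\<bar> ** \<bar>T\<bar>)"
    using norm_matrix_mono[OF E2(2)] gamma_nonneg by simp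
  also have "\<dots> \<le> gamma u (CARD('n) + 1) * (n * (spectral_norm T)\<^sup>2)"
    unfolding n_eq by (intro mult_left_mono norm_abs_gram_le gamma_nonneg)
  also have "\<dots> = (n * gamma u (CARD('n) + 1)) * t" by (simp add: t_def)
  also have "\<dots> \<le> 51 / 50 * (n * (n + 1) * u) * t"
    by (intro mult_right_mono gamma_Suc_n_le) (simp add: t_def)
  finally have nE2: "norm E2 \<le> 51 / 50 * (n * (n + 1) * u) * t" .
  have formT: "(norm (T *v v))\<^sup>2 = v \<bullet> (H *v v) + v \<bullet> (E2 *v v)" for v
    unfolding inner_gram[symmetric] E2(1) by (simp add: matrix_vector_mult_add_rdistrib inner_add_right)
  have "spectral_norm T \<le> sqrt (spectral_norm H + norm E2)"
  proof (rule spectral_norm_le)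
    fix x
    have "x \<bullet> (H *v x) \<le> norm x * (spectral_norm H * norm x)"
      by (intro order_trans[OF norm_cauchy_schwarz] mult_left_mono norm_vector_le_spectral_norm) simp
    then have "x \<bullet> (H *v x) \<le> spectral_norm H * (norm x)\<^sup>2"
      by (simp add: power2_eq_square mult_ac)
    then have "(norm (T *v x))\<^sup>2 \<le> (spectral_norm H + norm E2) * (norm x)\<^sup>2"
      unfolding formT distrib_right using abs_inner_mult_le[of x E2] by linarith
    then show "norm (T *v x) \<le> sqrt (spectral_norm H + norm E2) * norm x"
      by (metis norm_ge_zero real_le_rsqrt real_sqrt_abs real_sqrt_mult abs_norm_cancel)
  qed
  then have "t \<le> spectral_norm H + norm E2"
    unfolding t_def using spectral_norm_nonneg[of T] spectral_norm_nonneg[of H]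
    by (metis abs_of_nonneg add_nonneg_nonneg norm_ge_zero power_mono real_sqrt_pow2)
  moreover have "n * (n + 1) * u * t \<le> 1 / 96 * t"
    using eps_parts eps_le mnu_pos by (intro mult_right_mono) (auto simp: t_def)
  ultimately have tK: "t \<le> 1023 / 1000 * K" using nE2 nH abK \<open>0 \<le> a\<close> \<open>0 \<le> b\<close> K by linarith
  have "n * (n + 1) * u * t \<le> n * (n + 1) * u * (1023 / 1000 * K)"
    using tK nnu_pos by (intro mult_left_mono) auto
  then have nE2': "norm E2 \<le> 21 / 20 * b" using nE2 \<open>0 \<le> b\<close> by (simp add: b_def)
  have nT: "spectral_norm T \<le> 51 / 50 * mu"
  proof (rule power2_le_imp_le)
    have "(51 / 50 * mu)\<^sup>2 = 2601 / 2500 * K" by (simp add: K_def power_mult_distrib power_divide)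
    then show "(spectral_norm T)\<^sup>2 \<le> (51 / 50 * mu)\<^sup>2" using tK K unfolding t_def by linarith
  qed (simp add: \<open>0 \<le> mu\<close>)
  have nE: "norm (E1 + E2) \<le> 21 / 20 * eps * mu\<^sup>2"
    using norm_triangle_ineq[of E1 E2] nE1 nE2' ab \<open>0 \<le> a\<close>  unfolding K_def by linarith
  have eqT: "transpose T ** T = transpose Y ** Y + mat s + (E1 + E2)"
    by (simp add: E2(1) H_def E1(1))
  have lowT: "15 / 16 * lam * norm v \<le> norm (T *v v)" for v
  proof (rule power2_le_imp_le)
    have "\<bar>v \<bullet> (E2 *v v)\<bar> \<le> 21 / 20 * b * (norm v)\<^sup>2"
      by (rule order_trans[OF abs_inner_mult_le]) (intro mult_right_mono nE2', simp)
    then have "(lam\<^sup>2 - 51 / 50 * a - 21 / 20 * b) * (norm v)\<^sup>2 \<le> (norm (T *v v))\<^sup>2"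
      unfolding formT using lowH[of v] by (simp add: algebra_simps)
    moreover have "(15 / 16)\<^sup>2 * lam\<^sup>2 \<le> lam\<^sup>2 - 51 / 50 * a - 21 / 20 * b"
      unfolding power2_eq_square[of "15 / 16"] using lamab \<open>0 \<le> a\<close> \<open>0 \<le> b\<close> by simp
    then have "(15 / 16)\<^sup>2 * lam\<^sup>2 * (norm v)\<^sup>2 \<le> (lam\<^sup>2 - 51 / 50 * a - 21 / 20 * b) * (norm v)\<^sup>2"
      by (rule mult_right_mono) simp
    ultimately show "(15 / 16 * lam * norm v)\<^sup>2 \<le> (norm (T *v v))\<^sup>2"
      unfolding power_mult_distrib by linarith
  qed simp
  show thesis
    using that[OF _ UT IT eqT nE nT] lowT T by (simp add: H_def)
qed

text \<open>
  Every row is solved with its own perturbation of \<open>T\<close>, so the residual is not a product of \<open>Z\<close> with one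
  perturbation matrix. The Frobenius norm suits this situation: its square is the sum over the rows.
\<close>

lemma norm_triangular_solve_residual_le:
  assumes "upper_triangular T" "invertible T"
  shows "norm (trsolve Y T ** T - Y) \<le> gamma u CARD('n) * norm T * norm (trsolve Y T)"
proof -
  define Z where "Z = trsolve Y T"
  have "norm ((Z ** T - Y) $ i) \<le> gamma u CARD('n) * norm T * norm (Z $ i)" for i
  proof -
    obtain D where D: "(Z $ i) v* (T + D) = Y $ i" "\<bar>D\<bar> \<le> gamma u CARD('n) *\<^sub>R \<bar>T\<bar>"
      using trsolve_error[OF assms] unfolding Z_def by blast
    have "(Z ** T) $ i = Z $ i v* T"
      by (simp add: matrix_matrix_mult_def vector_matrix_mult_def vec_eq_iff mult.commute)
    then have "(Z ** T - Y) $ i = - (Z $ i v* D)"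
      by (simp add: D(1)[symmetric] vector_matrix_mult_add_rdistrib)
    then have "norm ((Z ** T - Y) $ i) = norm (transpose D *v (Z $ i))" by simp
    also have "\<dots> \<le> norm D * norm (Z $ i)"
      by (intro order_trans[OF norm_transpose_vector_le] mult_right_mono spectral_norm_le_norm) simp
    also have "\<dots> \<le> gamma u CARD('n) * norm T * norm (Z $ i)"
      using norm_matrix_mono[OF D(2)] gamma_nonneg by (intro mult_right_mono) (simp_all add: norm_matrix_abs)
    finally show ?thesis .
  qed
  then have "(norm ((Z ** T - Y) $ i))\<^sup>2 \<le> (gamma u CARD('n) * norm T)\<^sup>2 * (norm (Z $ i))\<^sup>2" for i
    by (metis norm_ge_zero power_mono power_mult_distrib)
  then have "(norm (Z ** T - Y))\<^sup>2 \<le> (gamma u CARD('n) * norm T * norm Z)\<^sup>2"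
    by (simp add: norm_matrix_sq_rows[of "Z ** T - Y"] norm_matrix_sq_rows[of Z] power_mult_distrib
        sum_distrib_left sum_mono del: vector_minus_component)
  then show ?thesis
    unfolding Z_def by (rule power2_le_imp_le) (simp add: gamma_nonneg)
qed

text \<open>
  The residual is bounded in terms of the computed solution \<open>Z\<close>. Dividing by \<open>T\<close> turns it into a bound of
  \<open>F = Z - P\<close> by \<open>f \<parallel>Z\<parallel>\<^sub>F / \<surd>n\<close>; as \<open>f \<le> 1/50\<close>, this determines \<open>\<parallel>Z\<parallel>\<^sub>F\<close> up to the factor
  \<open>50/49 = 1 / (1 - 1/50)\<close>.
\<close>

lemma triangular_solve:
  assumes T: "upper_triangular T" "invertible T" and Y: "Y = P ** T"
    and p: "spectral_norm P \<le> p" and t: "spectral_norm T \<le> t"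
    and low: "\<And>v. tau * norm v \<le> norm (T *v v)" and "0 < tau"
    and f: "n * gamma u CARD('n) * t \<le> f * tau" "f \<le> 1 / 50"
  obtains F where "trsolve Y T = P + F" "norm F \<le> 50 / 49 * p * f"
    "norm (trsolve Y T ** T - Y) \<le> 50 / 49 * p * (n * gamma u CARD('n) * t)"
proof -
  define Z where "Z = trsolve Y T"
  define g where "g = gamma u CARD('n) * t"
  define F where "F = Z - P"
  have "0 \<le> g" using t spectral_norm_nonneg[of T] gamma_nonneg by (simp add: g_def)
  have "0 \<le> p" using p spectral_norm_nonneg[of P] by linarith
  obtain S where S: "T ** S = mat 1" "spectral_norm S \<le> 1 / tau"
    using invertible_inverse[OF T(2) low \<open>0 < tau\<close>] by blast
  have sqn: "sqrt n * sqrt n = n" "sqrt n \<le> n" "0 \<le> sqrt n"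
    using n_ge_1 by (auto intro: real_le_lsqrt simp: power2_eq_square real_sqrt_le_iff sqrt_le_D)
  have nT: "norm T \<le> sqrt n * t"
    unfolding n_eq by (intro order_trans[OF norm_le_sqrt_spectral_norm] mult_left_mono t) simp
  have nP: "norm P \<le> sqrt n * p"
    unfolding n_eq by (intro order_trans[OF norm_le_sqrt_spectral_norm] mult_left_mono p) simp
  have "norm (Z ** T - Y) \<le> gamma u CARD('n) * norm T * norm Z"
    unfolding Z_def by (rule norm_triangular_solve_residual_le[OF T])
  also have "\<dots> \<le> gamma u CARD('n) * (sqrt n * t) * norm Z"
    by (intro mult_right_mono mult_left_mono nT gamma_nonneg) simp
  finally have res: "norm (Z ** T - Y) \<le> sqrt n * g * norm Z" by (simp add: g_def mult_ac)
  have "F ** T = Z ** T - Y"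
    by (simp add: F_def Y matrix_matrix_mult_def vec_eq_iff left_diff_distrib sum_subtractf)
  then have "F = (Z ** T - Y) ** S"
    by (metis S(1) matrix_mul_assoc matrix_mul_rid)
  then have "norm F \<le> norm (Z ** T - Y) * (1 / tau)"
    using norm_matrix_mult_le_right[of "Z ** T - Y" S] mult_left_mono[OF S(2), of "norm (Z ** T - Y)"]
    by simp
  then have nF: "norm F * tau \<le> norm (Z ** T - Y)" using \<open>0 < tau\<close> by (simp add: field_simps)
  have "sqrt n * g \<le> n * g" using sqn \<open>0 \<le> g\<close> by (intro mult_right_mono)
  also have "\<dots> \<le> f * tau" using f(1) by (simp add: g_def mult_ac)
  also have "\<dots> \<le> 1 / 50 * tau" using f(2) \<open>0 < tau\<close> by (intro mult_right_mono) auto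
  finally have "sqrt n * g * norm Z \<le> 1 / 50 * tau * norm Z" by (intro mult_right_mono) simp_all
  also have "\<dots> = 1 / 50 * norm Z * tau" by simp
  finally have "sqrt n * g * norm Z \<le> 1 / 50 * norm Z * tau" .
  then have "norm F * tau \<le> 1 / 50 * norm Z * tau" using nF res by linarith
  then have "norm F \<le> 1 / 50 * norm Z" using \<open>0 < tau\<close> by (simp only: mult_le_cancel_right_pos)
  moreover have "norm Z \<le> norm P + norm F" using norm_triangle_ineq[of P F] by (simp add: F_def)
  ultimately have nZ: "norm Z \<le> 50 / 49 * (sqrt n * p)" using nP by linarith
  have "norm (Z ** T - Y) \<le> sqrt n * g * (50 / 49 * (sqrt n * p))"
    using res mult_left_mono[OF nZ, of "sqrt n * g"] sqn \<open>0 \<le> g\<close> by simp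
  also have "\<dots> = 50 / 49 * p * ((sqrt n * sqrt n) * g)" by simp
  finally have res2: "norm (Z ** T - Y) \<le> 50 / 49 * p * (n * gamma u CARD('n) * t)"
    unfolding sqn(1) g_def by (simp add: mult_ac)
  also have "\<dots> \<le> 50 / 49 * p * (f * tau)" using f(1) \<open>0 \<le> p\<close> by (intro mult_left_mono) auto
  finally have "norm F * tau \<le> (50 / 49 * p * f) * tau" using nF by (simp add: mult_ac)
  then have "norm F \<le> 50 / 49 * p * f" using \<open>0 < tau\<close> by (simp only: mult_le_cancel_right_pos)
  then show thesis using that[of F] res2 by (simp add: F_def Z_def)
qed

text \<open>
  The exact quotient \<open>P = Y T\<^sup>-\<^sup>1\<close> satisfies \<open>P\<^sup>T P = I - T\<^sup>-\<^sup>T (s I + E) T\<^sup>-\<^sup>1\<close>. The shift only makes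
  \<open>P\<close> smaller, and the term with \<open>E\<close> is at most about \<open>eps (mu / lam)\<^sup>2 \<le> 1/9\<close>, so the norm of \<open>P\<close> hardly
  exceeds \<open>1\<close>.
\<close>

lemma cholesky_qr_bounds:
  assumes norm_le: "(spectral_norm Y)\<^sup>2 + s \<le> mu\<^sup>2" and "0 \<le> s" and "0 \<le> mu" and "0 < lam"
    and low: "\<And>v. lam\<^sup>2 * (norm v)\<^sup>2 \<le> (norm (Y *v v))\<^sup>2 + s * (norm v)\<^sup>2"
    and small: "9 * eps * mu\<^sup>2 \<le> lam\<^sup>2"
  obtains T E P F where "chol (gram Y + mat s) = Some T" "upper_triangular T" "invertible T"
    "transpose T ** T = transpose Y ** Y + mat s + E" "norm E \<le> 21 / 20 * eps * mu\<^sup>2"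
    "spectral_norm T \<le> 51 / 50 * mu" "\<forall>v. 15 / 16 * lam * norm v \<le> norm (T *v v)"
    "Y = P ** T" "spectral_norm P \<le> 107 / 100"
    "trsolve Y T = P + F" "norm F \<le> 5 / 8 * (eps * mu / lam)"
    "norm (trsolve Y T ** T - Y) \<le> 6 / 5 * (n\<^sup>2 * u) * mu" "spectral_norm (trsolve Y T) \<le> 11 / 10"
proof -
  obtain T E where T: "chol (gram Y + mat s) = Some T" "upper_triangular T" "invertible T"
    "transpose T ** T = transpose Y ** Y + mat s + E" "norm E \<le> 21 / 20 * eps * mu\<^sup>2"
    "spectral_norm T \<le> 51 / 50 * mu" and lowT': "\<forall>v. 15 / 16 * lam * norm v \<le> norm (T *v v)"
    by (rule cholesky_of_gram[OF assms])
  note lowT = lowT'[rule_format]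
  define tau where "tau = 15 / 16 * lam"
  define d where "d = eps * mu / lam"
  have "0 < tau" using \<open>0 < lam\<close> by (simp add: tau_def)
  have "0 \<le> d" using \<open>0 < lam\<close> \<open>0 \<le> mu\<close> eps_pos by (simp add: d_def)
  obtain S where S: "T ** S = mat 1" "S ** T = mat 1" "spectral_norm S \<le> 1 / tau"
    using invertible_inverse[OF T(3)] lowT \<open>0 < tau\<close> by (metis tau_def)
  define P where "P = Y ** S"
  have Y: "Y = P ** T" by (simp add: P_def matrix_mul_assoc[symmetric] S)
  have nP: "spectral_norm P \<le> 107 / 100"
  proof (rule spectral_norm_le, rule power2_le_imp_le)
    fix v
    define w where "w = S *v v"
    have Tw: "T *v w = v" by (simp add: w_def matrix_vector_mul_assoc S)
    have "w \<bullet> ((transpose T ** T) *v w) = (norm (Y *v w))\<^sup>2 + s * (norm w)\<^sup>2 + w \<bullet> (E *v w)"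
      unfolding T(4) by (simp add: matrix_vector_mult_add_rdistrib inner_add_right inner_gram
        mat_mult_vector power2_norm_eq_inner)
    then have "(norm v)\<^sup>2 = (norm (Y *v w))\<^sup>2 + s * (norm w)\<^sup>2 + w \<bullet> (E *v w)"
      by (simp add: inner_gram Tw)
    moreover have "\<bar>w \<bullet> (E *v w)\<bar> \<le> (21 / 20 * eps * mu\<^sup>2) * (norm w)\<^sup>2"
      by (rule order_trans[OF abs_inner_mult_le]) (intro mult_right_mono T(5), simp)
    moreover have "0 \<le> s * (norm w)\<^sup>2" using \<open>0 \<le> s\<close> by simp
    ultimately have 1: "(norm (Y *v w))\<^sup>2 \<le> (norm v)\<^sup>2 + (21 / 20 * eps * mu\<^sup>2) * (norm w)\<^sup>2"
      by linarith
    have "(15 / 16 * lam * norm w)\<^sup>2 \<le> (norm v)\<^sup>2"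
      using lowT[of w] \<open>0 < lam\<close> unfolding Tw by (intro power_mono) auto
    then have 2: "225 / 256 * (lam\<^sup>2 * (norm w)\<^sup>2) \<le> (norm v)\<^sup>2"
      by (simp add: power_mult_distrib power_divide)
    have "9 * eps * mu\<^sup>2 * (norm w)\<^sup>2 \<le> lam\<^sup>2 * (norm w)\<^sup>2"
      using small by (rule mult_right_mono) simp
    moreover have "(21 / 20 * eps * mu\<^sup>2) * (norm w)\<^sup>2 = 7 / 60 * (9 * eps * mu\<^sup>2 * (norm w)\<^sup>2)"
      by simp
    moreover have "(107 / 100)\<^sup>2 * (norm v)\<^sup>2 = 11449 / 10000 * (norm v)\<^sup>2"
      by (simp add: power_divide)
    ultimately have "(norm (Y *v w))\<^sup>2 \<le> (107 / 100)\<^sup>2 * (norm v)\<^sup>2"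
      using 1 2 zero_le_power2[of "norm v"] by linarith
    then show "(norm (P *v v))\<^sup>2 \<le> (107 / 100 * norm v)\<^sup>2"
      unfolding P_def w_def matrix_vector_mul_assoc[symmetric] power_mult_distrib .
  qed simp
  \<comment> \<open>The solve is well conditioned: \<open>d\<^sup>2 = eps (eps mu\<^sup>2 / lam\<^sup>2) \<le> 1/96 \<cdot> 1/9\<close>.\<close>
  have "d\<^sup>2 * lam\<^sup>2 = eps * (eps * mu\<^sup>2)"
    using \<open>0 < lam\<close> by (simp add: d_def power_divide power_mult_distrib power2_eq_square)
  also have "\<dots> \<le> 1 / 96 * (lam\<^sup>2 / 9)"
    using eps_le eps_pos small by (intro mult_mono) auto
  finally have "d\<^sup>2 * lam\<^sup>2 \<le> 1 / 864 * lam\<^sup>2" by simp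
  then have "d\<^sup>2 \<le> 1 / 864" using \<open>0 < lam\<close> by simp
  also have "\<dots> \<le> (36 / 1000)\<^sup>2" by (simp add: power2_eq_square)
  finally have dle: "d \<le> 36 / 1000" by (rule power2_le_imp_le) simp
  have "n * gamma u CARD('n) * (51 / 50 * mu) \<le> 51 / 50 * (n\<^sup>2 * u) * (51 / 50 * mu)"
    using gamma_n_le \<open>0 \<le> mu\<close> by (intro mult_right_mono) auto
  then have g1: "n * gamma u CARD('n) * (51 / 50 * mu) \<le> 2601 / 2500 * (n\<^sup>2 * u * mu)" by simp
  have "n\<^sup>2 * u * mu \<le> eps / 2 * mu" using n2u_le \<open>0 \<le> mu\<close> by (rule mult_right_mono)
  also have "\<dots> = d * lam / 2" using \<open>0 < lam\<close> by (simp add: d_def)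
  finally have "n\<^sup>2 * u * mu \<le> d * lam / 2" .
  moreover have "0 \<le> d * lam" using \<open>0 \<le> d\<close> \<open>0 < lam\<close> by simp
  ultimately have g2: "n * gamma u CARD('n) * (51 / 50 * mu) \<le> (111 / 200 * d) * tau"
    using g1 unfolding tau_def by linarith
  have f: "111 / 200 * d \<le> 1 / 50" using dle by simp
  obtain F where F: "trsolve Y T = P + F" "norm F \<le> 50 / 49 * (107 / 100) * (111 / 200 * d)"
    "norm (trsolve Y T ** T - Y) \<le> 50 / 49 * (107 / 100) * (n * gamma u CARD('n) * (51 / 50 * mu))"
    using triangular_solve[OF T(2,3) Y nP T(6) _ \<open>0 < tau\<close> g2 f] lowT unfolding tau_def by blast
  have nF: "norm F \<le> 5 / 8 * (eps * mu / lam)" using F(2) \<open>0 \<le> d\<close> by (simp add: d_def[symmetric])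
  have res: "norm (trsolve Y T ** T - Y) \<le> 6 / 5 * (n\<^sup>2 * u) * mu"
    using F(3) g1 mult_nonneg_nonneg[OF n2u_nonneg \<open>0 \<le> mu\<close>] by linarith
  have nZ: "spectral_norm (trsolve Y T) \<le> 11 / 10"
    using spectral_norm_add_le[of P F] spectral_norm_le_norm[of F] nP F(2) dle unfolding F(1) by simp
  show thesis by (rule that[OF T lowT' Y nP F(1) nF res nZ])
qed

text \<open>
  Without a shift, \<open>Z = P + F\<close> has \<open>Z\<^sup>T Z - I = F\<^sup>T F + P\<^sup>T F + F\<^sup>T P - G\<close> with \<open>G = T\<^sup>-\<^sup>T E T\<^sup>-\<^sup>1\<close>. The
  term \<open>G\<close> amplifies the factorization error by \<open>1 / lam\<^sup>2\<close>; the others are of first and second order in the solve error.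
\<close>

lemma cholesky_qr_orthogonality:
  assumes norm_le: "spectral_norm Y \<le> mu" and "0 < lam"
    and low: "\<And>v. lam * norm v \<le> norm (Y *v v)"
    and small: "9 * eps * mu\<^sup>2 \<le> lam\<^sup>2"
  obtains T where "chol (gram Y) = Some T" "upper_triangular T"
    "spectral_norm T \<le> 51 / 50 * mu"
    "norm (trsolve Y T ** T - Y) \<le> 6 / 5 * (n\<^sup>2 * u) * mu" "spectral_norm (trsolve Y T) \<le> 11 / 10"
    "norm (transpose (trsolve Y T) ** trsolve Y T - mat 1)
      \<le> 6 / 5 * (eps * (mu / lam)\<^sup>2) + 7 / 5 * (eps * (mu / lam))"
proof -
  have "0 \<le> mu" using norm_le spectral_norm_nonneg[of Y] by linarith
  have a1: "(spectral_norm Y)\<^sup>2 + 0 \<le> mu\<^sup>2"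
    using power_mono[OF norm_le spectral_norm_nonneg, of 2] by simp
  have a2: "lam\<^sup>2 * (norm v)\<^sup>2 \<le> (norm (Y *v v))\<^sup>2 + 0 * (norm v)\<^sup>2" for v
    using power_mono[OF low[of v], of 2] \<open>0 < lam\<close> by (simp add: power_mult_distrib)
  obtain T E P F where T: "chol (gram Y + mat 0) = Some T" "upper_triangular T" "invertible T"
    "transpose T ** T = transpose Y ** Y + mat 0 + E" "norm E \<le> 21 / 20 * eps * mu\<^sup>2"
    "spectral_norm T \<le> 51 / 50 * mu" and lowT': "\<forall>v. 15 / 16 * lam * norm v \<le> norm (T *v v)"
    and PF: "Y = P ** T" "spectral_norm P \<le> 107 / 100"
    "trsolve Y T = P + F" "norm F \<le> 5 / 8 * (eps * mu / lam)"
    and res: "norm (trsolve Y T ** T - Y) \<le> 6 / 5 * (n\<^sup>2 * u) * mu" "spectral_norm (trsolve Y T) \<le> 11 / 10"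
    by (rule cholesky_qr_bounds[OF a1 order_refl \<open>0 \<le> mu\<close> \<open>0 < lam\<close> a2 small])
  note lowT = lowT'[rule_format]
  have "0 < 15 / 16 * lam" using \<open>0 < lam\<close> by simp
  then obtain S where S: "T ** S = mat 1" "S ** T = mat 1" "spectral_norm S \<le> 1 / (15 / 16 * lam)"
    using invertible_inverse[OF T(3)] lowT by metis
  define r where "r = mu / lam"
  have "0 \<le> r" using \<open>0 \<le> mu\<close> \<open>0 < lam\<close> by (simp add: r_def)
  define G where "G = transpose S ** E ** S"
  have TS: "transpose S ** transpose T = mat 1"
    by (simp add: matrix_transpose_mul[symmetric] S)
  have "transpose T ** T = transpose T ** (transpose P ** P) ** T + E"
    unfolding T(4) mat_0 by (simp add: PF(1) matrix_transpose_mul matrix_mul_assoc)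
  then have "transpose S ** (transpose T ** T) ** S
      = transpose S ** (transpose T ** (transpose P ** P) ** T) ** S + G"
    by (simp add: G_def matrix_add_ldistrib matrix_add_rdistrib)
  moreover have "transpose S ** (transpose T ** T) ** S = mat 1"
    by (simp add: matrix_mul_assoc TS) (simp add: S)
  moreover have "transpose S ** (transpose T ** (transpose P ** P) ** T) ** S = transpose P ** P"
    by (metis S(1) TS matrix_mul_assoc matrix_mul_lid matrix_mul_rid)
  ultimately have PP: "transpose P ** P = mat 1 - G" by (simp add: eq_diff_eq)
  have "norm G \<le> spectral_norm S * norm E * spectral_norm S"
    unfolding G_def using norm_matrix_mult_le_right[of "transpose S ** E" S]
      mult_right_mono[OF norm_matrix_mult_le_left[of "transpose S" E] spectral_norm_nonneg[of S]]
    by (simp add: spectral_norm_transpose)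
  also have "\<dots> \<le> 1 / (15 / 16 * lam) * (21 / 20 * eps * mu\<^sup>2) * (1 / (15 / 16 * lam))"
    using S(3) T(5) \<open>0 < lam\<close> eps_pos by (intro mult_mono mult_nonneg_nonneg) (auto simp: spectral_norm_nonneg)
  also have "\<dots> = (21 / 20 * (256 / 225)) * (eps * r\<^sup>2)"
    using \<open>0 < lam\<close> by (simp add: r_def power_divide power2_eq_square)
  also have "\<dots> \<le> 6 / 5 * (eps * r\<^sup>2)"
    using eps_pos by (intro mult_right_mono) auto
  finally have nG: "norm G \<le> 6 / 5 * (eps * r\<^sup>2)" .
  define d where "d = eps * r"
  have "0 \<le> d" using \<open>0 \<le> r\<close> eps_pos by (simp add: d_def)
  have "9 * (eps * r\<^sup>2) \<le> 1"
    using small \<open>0 < lam\<close> by (simp add: r_def power_divide)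
  then have "eps * (eps * r\<^sup>2) \<le> 1 / 96 * (1 / 9)"
    using eps_le eps_pos by (intro mult_mono) auto
  also have "\<dots> \<le> (36 / 1000)\<^sup>2" by (simp add: power2_eq_square)
  finally have "d\<^sup>2 \<le> (36 / 1000)\<^sup>2" by (simp add: d_def power_mult_distrib power2_eq_square mult_ac)
  then have dle: "d \<le> 36 / 1000" by (rule power2_le_imp_le) simp
  have nF: "norm F \<le> 5 / 8 * d" using PF(4) by (simp add: d_def r_def)
  have "norm (transpose P ** F) \<le> 107 / 100 * (5 / 8 * d)"
    using norm_matrix_mult_le_left[of "transpose P" F] PF(2) nF
    by (intro order_trans[OF norm_matrix_mult_le_left] mult_mono) (auto simp: spectral_norm_transpose)
  moreover have "norm (transpose F ** P) = norm (transpose P ** F)"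
    using norm_transpose[of "transpose P ** F"] by (simp add: matrix_transpose_mul)
  moreover have "norm (transpose F ** F) \<le> (5 / 8 * d) * (5 / 8 * d)"
    using nF by (intro order_trans[OF norm_matrix_mult_le] mult_mono) (auto simp: norm_transpose \<open>0 \<le> d\<close>)
  moreover have "(5 / 8 * d) * (5 / 8 * d) \<le> (5 / 8 * d) * (5 / 8 * (36 / 1000))"
    using dle \<open>0 \<le> d\<close> by (intro mult_left_mono) auto
  moreover have "transpose (P + F) ** (P + F) - mat 1
      = transpose F ** F + (transpose P ** F + (transpose F ** P - G))"
    by (simp add: transpose_add matrix_add_ldistrib matrix_add_rdistrib PP)
  moreover have "norm (transpose F ** F + (transpose P ** F + (transpose F ** P - G)))
      \<le> norm (transpose F ** F) + (norm (transpose P ** F) + (norm (transpose F ** P) + norm G))"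
    by (meson add_left_mono norm_triangle_ineq norm_triangle_ineq4 order_trans)
  ultimately have "norm (transpose (trsolve Y T) ** trsolve Y T - mat 1) \<le> 6 / 5 * (eps * r\<^sup>2) + 7 / 5 * d"
    using nG \<open>0 \<le> d\<close> unfolding PF(3) by simp
  then show thesis
    using that[OF _ T(2,6) res] T(1) by (simp add: mat_0 r_def d_def)
qed

section \<open>The three steps\<close>

text \<open>
  The shift is \<open>11 eps \<parallel>X\<parallel>\<^sup>2\<close>, which leaves room for \<open>lam\<^sup>2 = 3.3\<^sup>2 eps \<parallel>X\<parallel>\<^sup>2\<close> and, with
  \<open>1 + 11/96 \<le> 1.06\<^sup>2\<close>, for \<open>mu = 1.06 \<parallel>X\<parallel>\<close>. For the smallest singular value of \<open>P = X T\<^sup>-\<^sup>1\<close> put \<open>v = T w\<close>: then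
  \<open>\<parallel>v\<parallel>\<^sup>2\<close> exceeds \<open>\<parallel>P v\<parallel>\<^sup>2 = \<parallel>X w\<parallel>\<^sup>2\<close> by at most \<open>12.2 eps \<parallel>X\<parallel>\<^sup>2 \<parallel>w\<parallel>\<^sup>2\<close>, and after multiplication by \<open>eps\<close> this is
  a small part of \<open>\<parallel>X w\<parallel>\<^sup>2\<close> because \<open>96 eps \<parallel>X\<parallel> \<parallel>w\<parallel> \<le> \<sigma>\<^sub>n \<parallel>w\<parallel> \<le> \<parallel>X w\<parallel>\<close>. Hence \<open>P\<close> has smallest singular
  value at least \<open>9 \<surd>eps\<close>, and the solve error takes away at most \<open>\<surd>eps\<close>.
\<close>

lemma shifted_cholesky_qr_conditioning:
  assumes "0 < spectral_norm X"
    and sig: "96 * eps * spectral_norm X \<le> sigma_min X"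
  obtains T where "chol (gram X + mat (shift X)) = Some T" "upper_triangular T"
    "spectral_norm T \<le> 109 / 100 * spectral_norm X"
    "norm (trsolve X T ** T - X) \<le> 13 / 10 * (n\<^sup>2 * u) * spectral_norm X"
    "spectral_norm (trsolve X T) \<le> 11 / 10"
    "\<And>v. 8 * sqrt eps * norm v \<le> norm (trsolve X T *v v)"
proof -
  define x where "x = spectral_norm X"
  define e where "e = sqrt eps"
  define s where "s = 11 * eps * x\<^sup>2"
  have "0 < x" using assms(1) by (simp add: x_def)
  have "0 < e" and e2: "e\<^sup>2 = eps" using eps_pos by (simp_all add: e_def)
  have shift: "shift X = s"
    by (simp add: shift_def Let_def s_def x_def eps_eq m_eq n_eq)
  have "0 \<le> s" using eps_pos by (simp add: s_def)
  have ex: "eps * x\<^sup>2 \<le> 1 / 96 * x\<^sup>2" using eps_le by (rule mult_right_mono) simp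
  have mu2: "(53 / 50 * x)\<^sup>2 = 2809 / 2500 * x\<^sup>2" by (simp add: power_mult_distrib power_divide)
  have lam2: "(33 / 10 * e * x)\<^sup>2 = 1089 / 100 * (eps * x\<^sup>2)"
    by (simp add: power_mult_distrib power_divide e2)
  have a1: "(spectral_norm X)\<^sup>2 + s \<le> (53 / 50 * x)\<^sup>2"
    unfolding mu2 x_def[symmetric] using ex zero_le_power2[of x] unfolding s_def by linarith
  have a2: "(33 / 10 * e * x)\<^sup>2 * (norm v)\<^sup>2 \<le> (norm (X *v v))\<^sup>2 + s * (norm v)\<^sup>2" for v
  proof -
    have "(33 / 10 * e * x)\<^sup>2 * (norm v)\<^sup>2 \<le> s * (norm v)\<^sup>2"
      unfolding lam2 s_def using eps_pos by (intro mult_right_mono) auto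
    then show ?thesis using zero_le_power2[of "norm (X *v v)"] by linarith
  qed
  have a3: "9 * eps * (53 / 50 * x)\<^sup>2 \<le> (33 / 10 * e * x)\<^sup>2"
    unfolding mu2 lam2 using eps_pos by simp
  have a4: "0 \<le> 53 / 50 * x" and a5: "0 < 33 / 10 * e * x"
    using \<open>0 < x\<close> \<open>0 < e\<close> by simp_all
  obtain T E P F where T: "chol (gram X + mat s) = Some T" "upper_triangular T" "invertible T"
    "transpose T ** T = transpose X ** X + mat s + E" "norm E \<le> 21 / 20 * eps * (53 / 50 * x)\<^sup>2"
    "spectral_norm T \<le> 51 / 50 * (53 / 50 * x)" "\<forall>v. 15 / 16 * (33 / 10 * e * x) * norm v \<le> norm (T *v v)"
    and PF: "X = P ** T" "spectral_norm P \<le> 107 / 100" "trsolve X T = P + F"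
      "norm F \<le> 5 / 8 * (eps * (53 / 50 * x) / (33 / 10 * e * x))"
    and res: "norm (trsolve X T ** T - X) \<le> 6 / 5 * (n\<^sup>2 * u) * (53 / 50 * x)"
      "spectral_norm (trsolve X T) \<le> 11 / 10"
    by (rule cholesky_qr_bounds[OF a1 \<open>0 \<le> s\<close> a4 a5 a2 a3])
  obtain S where S: "T ** S = mat 1" using T(3) by (auto simp: invertible_def)
  have "5 / 8 * (eps * (53 / 50 * x) / (33 / 10 * e * x)) = 53 / 264 * e"
    using \<open>0 < x\<close> \<open>0 < e\<close> by (simp add: e2[symmetric] power2_eq_square)
  then have "norm F \<le> 53 / 264 * e" using PF(4) by (simp only:)
  then have nF: "norm F \<le> e" using \<open>0 < e\<close> by linarith
  have nE: "norm E \<le> 6 / 5 * (eps * x\<^sup>2)"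
  proof -
    have "21 / 20 * eps * (53 / 50 * x)\<^sup>2 = 21 / 20 * (2809 / 2500) * (eps * x\<^sup>2)"
      unfolding mu2 by simp
    moreover have "0 \<le> eps * x\<^sup>2" using eps_pos by simp
    ultimately show ?thesis using T(5) by linarith
  qed
  have lowP: "9 * e * norm v \<le> norm (P *v v)" for v
  proof (rule power2_le_imp_le)
    define w where "w = S *v v"
    have Tw: "T *v w = v" by (simp add: w_def matrix_vector_mul_assoc S)
    have Pv: "P *v v = X *v w"
      by (subst PF(1)) (simp add: matrix_vector_mul_assoc[symmetric] Tw)
    have "w \<bullet> ((transpose T ** T) *v w) = (norm (X *v w))\<^sup>2 + s * (norm w)\<^sup>2 + w \<bullet> (E *v w)"
      unfolding T(4) by (simp add: matrix_vector_mult_add_rdistrib inner_add_right inner_gram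
        mat_mult_vector power2_norm_eq_inner)
    then have "(norm v)\<^sup>2 = (norm (X *v w))\<^sup>2 + s * (norm w)\<^sup>2 + w \<bullet> (E *v w)"
      by (simp add: inner_gram Tw)
    moreover have "\<bar>w \<bullet> (E *v w)\<bar> \<le> 6 / 5 * (eps * x\<^sup>2) * (norm w)\<^sup>2"
      by (rule order_trans[OF abs_inner_mult_le]) (intro mult_right_mono nE, simp)
    ultimately have "(norm v)\<^sup>2 \<le> (norm (X *v w))\<^sup>2 + 61 / 5 * (eps * x\<^sup>2 * (norm w)\<^sup>2)"
      unfolding s_def by (simp add: algebra_simps)
    then have "eps * (norm v)\<^sup>2 \<le> eps * ((norm (X *v w))\<^sup>2 + 61 / 5 * (eps * x\<^sup>2 * (norm w)\<^sup>2))"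
      using eps_pos by (intro mult_left_mono) auto
    also have "\<dots> = eps * (norm (X *v w))\<^sup>2 + 61 / 5 / 9216 * (96 * eps * x * norm w)\<^sup>2"
      by (simp add: algebra_simps power2_eq_square)
    also have "\<dots> \<le> 1 / 96 * (norm (X *v w))\<^sup>2 + 61 / 5 / 9216 * (norm (X *v w))\<^sup>2"
    proof (intro add_mono mult_right_mono mult_left_mono power_mono eps_le)
      have "96 * eps * x * norm w \<le> sigma_min X * norm w"
        using sig unfolding x_def by (rule mult_right_mono) simp
      also have "\<dots> \<le> norm (X *v w)" by (rule sigma_min_le)
      finally show "96 * eps * x * norm w \<le> norm (X *v w)" .
    qed (use eps_pos \<open>0 < x\<close> in auto)
    finally have "81 * (eps * (norm v)\<^sup>2) \<le> (norm (P *v v))\<^sup>2"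
      unfolding Pv using zero_le_power2[of "norm (X *v w)"] by linarith
    then show "(9 * e * norm v)\<^sup>2 \<le> (norm (P *v v))\<^sup>2"
      by (simp add: power_mult_distrib e2)
  qed simp
  have lowZ: "8 * sqrt eps * norm v \<le> norm (trsolve X T *v v)" for v
  proof -
    have "norm (F *v v) \<le> norm F * norm v"
      by (intro order_trans[OF norm_vector_le_spectral_norm] mult_right_mono spectral_norm_le_norm) simp
    also have "\<dots> \<le> e * norm v" using nF by (rule mult_right_mono) simp
    finally have "norm (F *v v) \<le> e * norm v" .
    moreover have "norm (P *v v) \<le> norm (P *v v + F *v v) + norm (F *v v)"
      using norm_triangle_ineq4[of "P *v v + F *v v" "F *v v"] by simp
    ultimately show ?thesis
      using lowP[of v] unfolding PF(3) matrix_vector_mult_add_rdistrib e_def[symmetric] by linarith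
  qed
  show thesis
  proof (rule that[OF _ T(2) _ _ res(2) lowZ])
    show "chol (gram X + mat (shift X)) = Some T" using T(1) by (simp add: shift)
    show "spectral_norm T \<le> 109 / 100 * spectral_norm X"
      using T(6) \<open>0 < x\<close> unfolding x_def by linarith
    have "0 \<le> n\<^sup>2 * u * x" using u_pos \<open>0 < x\<close> by simp
    then show "norm (trsolve X T ** T - X) \<le> 13 / 10 * (n\<^sup>2 * u) * spectral_norm X"
      using res(1) unfolding x_def by linarith
  qed
qed

text \<open>
  With \<open>mu / lam = 1.1 / (8 \<surd>eps)\<close> the orthogonality bound is at most \<open>0.045\<close>, which is less than both
  \<open>1 - 0.975\<^sup>2\<close> and \<open>1.025\<^sup>2 - 1\<close>.
\<close>

lemma cholesky_qr_singular_values_near_1: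
  assumes "spectral_norm Y \<le> 11 / 10"
    and low: "\<And>v. 8 * sqrt eps * norm v \<le> norm (Y *v v)"
  obtains T where "chol (gram Y) = Some T" "upper_triangular T"
    "spectral_norm T \<le> 113 / 100"
    "norm (trsolve Y T ** T - Y) \<le> 4 / 3 * (n\<^sup>2 * u)" "spectral_norm (trsolve Y T) \<le> 41 / 40"
    "\<And>v. 39 / 40 * norm v \<le> norm (trsolve Y T *v v)"
proof -
  define e where "e = sqrt eps"
  have "0 < e" and e2: "e\<^sup>2 = eps" using eps_pos by (simp_all add: e_def)
  have "e \<le> 52 / 500"
    by (rule power2_le_imp_le, unfold e2) (use eps_le in \<open>simp_all add: power2_eq_square\<close>)
  have "9 * eps * (11 / 10)\<^sup>2 \<le> (8 * e)\<^sup>2"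
    using eps_pos by (simp add: power_mult_distrib e2 power_divide)
  then obtain T where T: "chol (gram Y) = Some T" "upper_triangular T"
    "spectral_norm T \<le> 51 / 50 * (11 / 10)"
    "norm (trsolve Y T ** T - Y) \<le> 6 / 5 * (n\<^sup>2 * u) * (11 / 10)"
    "norm (transpose (trsolve Y T) ** trsolve Y T - mat 1)
      \<le> 6 / 5 * (eps * (11 / 10 / (8 * e))\<^sup>2) + 7 / 5 * (eps * (11 / 10 / (8 * e)))"
    using cholesky_qr_orthogonality[OF assms(1), of "8 * e"] low \<open>0 < e\<close> unfolding e_def by auto
  have "eps * (11 / 10 / (8 * e))\<^sup>2 = 121 / 6400"
    using \<open>0 < e\<close> by (simp add: e2[symmetric] power2_eq_square)
  moreover have "eps * (11 / 10 / (8 * e)) = 11 / 80 * e"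
    using \<open>0 < e\<close> by (simp add: e2[symmetric] power2_eq_square)
  ultimately have orth: "norm (transpose (trsolve Y T) ** trsolve Y T - mat 1) \<le> 9 / 200"
    using T(5) \<open>e \<le> 52 / 500\<close> by simp
  show thesis
  proof (rule that[OF T(1,2)])
    show "spectral_norm T \<le> 113 / 100" using T(3) by simp
    show "norm (trsolve Y T ** T - Y) \<le> 4 / 3 * (n\<^sup>2 * u)"
      using T(4) n2u_nonneg by linarith
    show "spectral_norm (trsolve Y T) \<le> 41 / 40"
    proof (rule spectral_norm_le, rule power2_le_imp_le)
      fix v :: "(real, 'n) vec"
      have "(41 / 40 * norm v)\<^sup>2 = 1681 / 1600 * (norm v)\<^sup>2"
        by (simp add: power_mult_distrib power_divide)
      moreover have "(1 + 9 / 200) * (norm v)\<^sup>2 \<le> 1681 / 1600 * (norm v)\<^sup>2"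
        by (intro mult_right_mono) simp_all
      ultimately show "(norm (trsolve Y T *v v))\<^sup>2 \<le> (41 / 40 * norm v)\<^sup>2"
        using singular_values_near_1_if_gram_near_mat_1(2)[OF orth, of v] by linarith
    qed simp
    fix v :: "(real, 'n) vec"
    show "39 / 40 * norm v \<le> norm (trsolve Y T *v v)"
    proof (rule power2_le_imp_le)
      have "(39 / 40 * norm v)\<^sup>2 = 1521 / 1600 * (norm v)\<^sup>2"
        by (simp add: power_mult_distrib power_divide)
      moreover have "1521 / 1600 * (norm v)\<^sup>2 \<le> (1 - 9 / 200) * (norm v)\<^sup>2"
        by (intro mult_right_mono) simp_all
      ultimately show "(39 / 40 * norm v)\<^sup>2 \<le> (norm (trsolve Y T *v v))\<^sup>2"
        using singular_values_near_1_if_gram_near_mat_1(1)[OF orth, of v] by linarith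
    qed simp
  qed
qed

lemma cholesky_qr_orthonormal:
  assumes "spectral_norm Y \<le> 41 / 40"
    and low: "\<And>v. 39 / 40 * norm v \<le> norm (Y *v v)"
  obtains T where "chol (gram Y) = Some T" "upper_triangular T"
    "spectral_norm T \<le> 21 / 20"
    "norm (trsolve Y T ** T - Y) \<le> 5 / 4 * (n\<^sup>2 * u)" "spectral_norm (trsolve Y T) \<le> 11 / 10"
    "norm (transpose (trsolve Y T) ** trsolve Y T - mat 1) \<le> 3 * eps"
proof -
  have "9 * eps * (41 / 40)\<^sup>2 \<le> (39 / 40)\<^sup>2"
    using eps_le by (simp add: power_divide)
  then obtain T where T: "chol (gram Y) = Some T" "upper_triangular T"
    "spectral_norm T \<le> 51 / 50 * (41 / 40)"
    "norm (trsolve Y T ** T - Y) \<le> 6 / 5 * (n\<^sup>2 * u) * (41 / 40)"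
    "spectral_norm (trsolve Y T) \<le> 11 / 10"
    "norm (transpose (trsolve Y T) ** trsolve Y T - mat 1)
      \<le> 6 / 5 * (eps * (41 / 40 / (39 / 40))\<^sup>2) + 7 / 5 * (eps * (41 / 40 / (39 / 40)))"
    using cholesky_qr_orthogonality[OF assms(1), of "39 / 40"] low by auto
  show thesis
  proof (rule that[OF T(1,2) _ _ T(5)])
    show "spectral_norm T \<le> 21 / 20" using T(3) by simp
    show "norm (trsolve Y T ** T - Y) \<le> 5 / 4 * (n\<^sup>2 * u)"
      using T(4) n2u_nonneg by linarith
    show "norm (transpose (trsolve Y T) ** trsolve Y T - mat 1) \<le> 3 * eps"
      using T(6) eps_pos by (simp add: power_divide)
  qed
qed

section \<open>Accumulation of the triangular factors\<close>

lemma norm_mult_error_le: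
  "norm (mult S T - S ** T) \<le> 51 / 50 * (n\<^sup>2 * u) * (spectral_norm S * spectral_norm T)"
proof -
  have "norm (mult S T - S ** T) \<le> gamma u CARD('n) * norm (\<bar>S\<bar> ** \<bar>T\<bar>)"
    using norm_matrix_mono[OF mult_error[of S T]] gamma_nonneg by simp
  also have "\<dots> \<le> gamma u CARD('n) * ((sqrt n * spectral_norm S) * (sqrt n * spectral_norm T))"
    unfolding n_eq
    by (intro mult_left_mono order_trans[OF norm_abs_mult_le] mult_mono norm_le_sqrt_spectral_norm
        gamma_nonneg) (auto simp: spectral_norm_nonneg)
  also have "\<dots> = (n * gamma u CARD('n)) * (spectral_norm S * spectral_norm T)"
    using n_ge_1 by simp
  also have "\<dots> \<le> 51 / 50 * (n\<^sup>2 * u) * (spectral_norm S * spectral_norm T)"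
    by (intro mult_right_mono gamma_n_le mult_nonneg_nonneg spectral_norm_nonneg)
  finally show ?thesis .
qed

text \<open>
  The error bound has the same triangular zero pattern as the exact product, so no entry below the
  diagonal can be created by rounding.
\<close>

lemma upper_triangular_mult:
  assumes "upper_triangular S" "upper_triangular T"
  shows "upper_triangular (mult S T)"
  unfolding upper_triangular_def
proof (intro allI impI)
  fix i j :: 'n assume "j < i"
  have abs_tri: "upper_triangular \<bar>S\<bar>" "upper_triangular \<bar>T\<bar>"
    using assms by (auto simp: upper_triangular_def abs_vec_def)
  have "\<bar>(mult S T - S ** T) $ i $ j\<bar> \<le> gamma u CARD('n) * ((\<bar>S\<bar> ** \<bar>T\<bar>) $ i $ j)"
    using mult_error[of S T] by (simp add: less_eq_vec_def abs_vec_def)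
  then show "mult S T $ i $ j = 0"
    using upper_triangular_product_entry_eq_0[OF assms \<open>j < i\<close>]
      upper_triangular_product_entry_eq_0[OF abs_tri \<open>j < i\<close>] by simp
qed

text \<open>
  Replacing in turn \<open>mult\<close> by the exact product and \<open>Q\<^sub>i T\<^sub>i\<close> by \<open>Q\<^bsub>i-1\<^esub>\<close> leads from \<open>Q\<^sub>3 R\<close> back to \<open>X\<close>. Each of the five
  errors on the way is of size \<open>n\<^sup>2 u \<parallel>X\<parallel>\<close>, with constants that add up to about \<open>7\<close>.
\<close>

lemma product_residual_le:
  assumes T: "spectral_norm T1 \<le> 109 / 100 * x" "spectral_norm T2 \<le> 113 / 100" "spectral_norm T3 \<le> 21 / 20"
    and Q: "spectral_norm Q2 \<le> 41 / 40" "spectral_norm Q3 \<le> 11 / 10"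
    and res: "norm (Q1 ** T1 - X) \<le> 13 / 10 * (n\<^sup>2 * u) * x" "norm (Q2 ** T2 - Q1) \<le> 4 / 3 * (n\<^sup>2 * u)"
      "norm (Q3 ** T3 - Q2) \<le> 5 / 4 * (n\<^sup>2 * u)"
  shows "norm (Q3 ** mult T3 (mult T2 T1) - X) \<le> 15 * n\<^sup>2 * u * x"
proof -
  define k where "k = n\<^sup>2 * u"
  define R where "R = mult T2 T1"
  define G2 where "G2 = mult T2 T1 - T2 ** T1"
  define G3 where "G3 = mult T3 R - T3 ** R"
  have "0 \<le> x" using T(1) spectral_norm_nonneg[of T1] by linarith
  have k: "0 \<le> k" "k \<le> 1 / 100" using u_pos n2u_le eps_le by (simp_all add: k_def)
  have kx: "k * x \<le> 1 / 100 * x" using k(2) \<open>0 \<le> x\<close> by (rule mult_right_mono)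
  note nonneg = spectral_norm_nonneg k(1) \<open>0 \<le> x\<close>
  have T21: "spectral_norm T2 * spectral_norm T1 \<le> 113 / 100 * (109 / 100 * x)"
    using T by (intro mult_mono) (auto simp: nonneg)
  have "51 / 50 * k * (spectral_norm T2 * spectral_norm T1) \<le> 51 / 50 * k * (113 / 100 * (109 / 100 * x))"
    using k by (intro mult_left_mono T21) auto
  then have G2: "norm G2 \<le> 13 / 10 * (k * x)"
    using norm_mult_error_le[of T2 T1] mult_nonneg_nonneg[OF k(1) \<open>0 \<le> x\<close>]
    unfolding k_def[symmetric] G2_def by linarith
  have "spectral_norm R \<le> spectral_norm (T2 ** T1) + spectral_norm G2"
    using spectral_norm_add_le[of "T2 ** T1" G2] by (simp add: R_def G2_def)
  then have R: "spectral_norm R \<le> 5 / 4 * x"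
    using spectral_norm_mult_le[of T2 T1] spectral_norm_le_norm[of G2] G2 T21 kx \<open>0 \<le> x\<close> by linarith
  have "51 / 50 * k * (spectral_norm T3 * spectral_norm R) \<le> 51 / 50 * k * (21 / 20 * (5 / 4 * x))"
    using k T R by (intro mult_left_mono mult_mono) (auto simp: nonneg)
  then have G3: "norm G3 \<le> 7 / 5 * (k * x)"
    using norm_mult_error_le[of T3 R] mult_nonneg_nonneg[OF k(1) \<open>0 \<le> x\<close>]
    unfolding k_def[symmetric] G3_def by linarith
  have 2: "norm ((Q2 ** T2 - Q1) ** T1) \<le> (4 / 3 * k) * (109 / 100 * x)"
    using T res k by (intro order_trans[OF norm_matrix_mult_le_right] mult_mono) (auto simp: nonneg k_def)
  have 3: "norm ((Q3 ** T3 - Q2) ** R) \<le> (5 / 4 * k) * (5 / 4 * x)"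
    using R res k by (intro order_trans[OF norm_matrix_mult_le_right] mult_mono) (auto simp: nonneg k_def)
  have 4: "norm (Q2 ** G2) \<le> 41 / 40 * (13 / 10 * (k * x))"
    using Q G2 by (intro order_trans[OF norm_matrix_mult_le_left] mult_mono) (auto simp: nonneg)
  have 5: "norm (Q3 ** G3) \<le> 11 / 10 * (7 / 5 * (k * x))"
    using Q G3 by (intro order_trans[OF norm_matrix_mult_le_left] mult_mono) (auto simp: nonneg)
  have "Q3 ** mult T3 (mult T2 T1) - X = (Q1 ** T1 - X) + ((Q2 ** T2 - Q1) ** T1
      + (Q2 ** G2 + ((Q3 ** T3 - Q2) ** R + Q3 ** G3)))"
  proof -
    have "mult T3 (mult T2 T1) = T3 ** R + G3" "R = T2 ** T1 + G2"
      by (simp_all add: G3_def R_def G2_def)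
    then show ?thesis
      by (simp add: matrix_diff_rdistrib matrix_add_ldistrib matrix_mul_assoc)
  qed
  also have "norm \<dots> \<le> norm (Q1 ** T1 - X) + (norm ((Q2 ** T2 - Q1) ** T1)
      + (norm (Q2 ** G2) + (norm ((Q3 ** T3 - Q2) ** R) + norm (Q3 ** G3))))"
    by (intro order_trans[OF norm_triangle_ineq] add_left_mono order_refl)
  also have "\<dots> \<le> 15 * (k * x)"
    using res(1) 2 3 4 5 mult_nonneg_nonneg[OF k(1) \<open>0 \<le> x\<close>] unfolding k_def[symmetric] by simp
  finally show ?thesis by (simp add: k_def)
qed

section \<open>The shifted algorithm\<close>

lemma shiftedCholeskyQR3_bounds:
  assumes "0 < spectral_norm X"
    and "96 * eps * spectral_norm X \<le> sigma_min X"
  shows "\<exists>Q R. shiftedCholeskyQR3 X = Some (Q, R) \<and> upper_triangular R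
    \<and> norm (transpose Q ** Q - mat 1) \<le> 3 * eps
    \<and> norm (Q ** R - X) \<le> 15 * n\<^sup>2 * u * spectral_norm X"
proof -
  obtain T1 where 1: "chol (gram X + mat (shift X)) = Some T1" "upper_triangular T1"
    "spectral_norm T1 \<le> 109 / 100 * spectral_norm X"
    "norm (trsolve X T1 ** T1 - X) \<le> 13 / 10 * (n\<^sup>2 * u) * spectral_norm X"
    "spectral_norm (trsolve X T1) \<le> 11 / 10"
    "\<And>v. 8 * sqrt eps * norm v \<le> norm (trsolve X T1 *v v)"
    using shifted_cholesky_qr_conditioning[OF assms] by blast
  define Q1 where "Q1 = trsolve X T1"
  obtain T2 where 2: "chol (gram Q1) = Some T2" "upper_triangular T2" "spectral_norm T2 \<le> 113 / 100"
    "norm (trsolve Q1 T2 ** T2 - Q1) \<le> 4 / 3 * (n\<^sup>2 * u)" "spectral_norm (trsolve Q1 T2) \<le> 41 / 40"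
    "\<And>v. 39 / 40 * norm v \<le> norm (trsolve Q1 T2 *v v)"
    using cholesky_qr_singular_values_near_1[of Q1] 1(5,6) unfolding Q1_def by blast
  define Q2 where "Q2 = trsolve Q1 T2"
  obtain T3 where 3: "chol (gram Q2) = Some T3" "upper_triangular T3" "spectral_norm T3 \<le> 21 / 20"
    "norm (trsolve Q2 T3 ** T3 - Q2) \<le> 5 / 4 * (n\<^sup>2 * u)" "spectral_norm (trsolve Q2 T3) \<le> 11 / 10"
    "norm (transpose (trsolve Q2 T3) ** trsolve Q2 T3 - mat 1) \<le> 3 * eps"
    using cholesky_qr_orthonormal[of Q2] 2(5,6) unfolding Q2_def by blast
  define Q3 where "Q3 = trsolve Q2 T3"
  have "shiftedCholeskyQR3 X = Some (Q3, mult T3 (mult T2 T1))"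
    using 1(1) 2(1) 3(1) by (simp add: shiftedCholeskyQR3_def cholesky_qr_step_def Q1_def Q2_def Q3_def)
  moreover have "upper_triangular (mult T3 (mult T2 T1))"
    by (intro upper_triangular_mult 1(2) 2(2) 3(2))
  moreover have "norm (Q3 ** mult T3 (mult T2 T1) - X) \<le> 15 * n\<^sup>2 * u * spectral_norm X"
    using product_residual_le[OF 1(3) 2(3) 3(3) _ _ 1(4) _ ] 2(4,5) 3(4,5)
    unfolding Q1_def Q2_def Q3_def by blast
  ultimately show ?thesis using 3(6) unfolding Q3_def by blast
qed

end

theorem theorem4p1:
  fixes u :: real
    and gram :: "('m::finite, 'n::{finite,linorder}) rmat \<Rightarrow> ('n, 'n) rmat"
    and chol :: "('n, 'n) rmat \<Rightarrow> ('n, 'n) rmat option"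
    and trsolve :: "('m, 'n) rmat \<Rightarrow> ('n, 'n) rmat \<Rightarrow> ('m, 'n) rmat"
    and mult :: "('n, 'n) rmat \<Rightarrow> ('n, 'n) rmat \<Rightarrow> ('n, 'n) rmat"
    and X :: "('m, 'n) rmat"
    and m n :: real
  defines "m \<equiv> real CARD('m)" and "n \<equiv> real CARD('n)"
  assumes "fp_arithmetic u gram chol trsolve mult"
    and "m \<ge> n"
    and "ereal (6 * n\<^sup>2 * u) * kappa2 X < 1"
    and "m * n * u \<le> 1 / 64"
    and "n * (n + 1) * u \<le> 1 / 64"
    and "kappa2 X \<le> ereal (inverse u / (96 * (m * n + n * (n + 1))))"
  shows "\<exists>Q R. fp_arithmetic.shiftedCholeskyQR3 u gram chol trsolve mult X = Some (Q, R)
           \<and> upper_triangular R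
           \<and> frobenius_norm (transpose Q ** Q - mat 1) \<le> 6 * (m * n + n * (n + 1)) * u
           \<and> frobenius_norm (Q ** R - X) / spectral_norm X \<le> 15 * n\<^sup>2 * u"
proof -
  interpret fp_arithmetic u gram chol trsolve mult by fact
  define eps where "eps = (m * n + n * (n + 1)) * u"
  define x where "x = spectral_norm X"
  have "1 \<le> n" by (simp add: n_def Suc_le_eq)
  then have "0 < m * n + n * (n + 1)" using \<open>m \<ge> n\<close> by (intro add_pos_pos mult_pos_pos) auto
  then have "0 < eps" using u_pos by (simp add: eps_def)
  have "sigma_min X \<noteq> 0" using assms(8) by (auto simp: kappa2_def)
  then have "0 < sigma_min X" using sigma_min_nonneg[of X] by simp
  then have "0 < x" using sigma_min_le_spectral_norm[of X] by (simp add: x_def)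
  have "x / sigma_min X \<le> inverse u / (96 * (m * n + n * (n + 1)))"
    using assms(8) \<open>sigma_min X \<noteq> 0\<close> by (simp add: kappa2_def x_def)
  also have "\<dots> = 1 / (96 * eps)" by (simp add: eps_def inverse_eq_divide)
  finally have sig: "96 * eps * x \<le> sigma_min X"
    using \<open>0 < eps\<close> \<open>0 < sigma_min X\<close> by (simp add: field_simps)
  also have "\<dots> \<le> x" unfolding x_def by (rule sigma_min_le_spectral_norm)
  finally have "eps \<le> 1 / 96" using \<open>0 < x\<close> by simp
  then interpret small_roundoff u gram chol trsolve mult m n eps
    using \<open>m \<ge> n\<close> by unfold_locales (simp_all add: m_def n_def eps_def)
  obtain Q R where QR: "shiftedCholeskyQR3 X = Some (Q, R)" "upper_triangular R"
    "norm (transpose Q ** Q - mat 1) \<le> 3 * eps" "norm (Q ** R - X) \<le> 15 * n\<^sup>2 * u * x"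
    using shiftedCholeskyQR3_bounds[of X] \<open>0 < x\<close> sig unfolding x_def by blast
  have "norm (transpose Q ** Q - mat 1) \<le> 6 * (m * n + n * (n + 1)) * u"
    using QR(3) \<open>0 < eps\<close> unfolding mult.assoc eps_def by linarith
  moreover have "norm (Q ** R - X) / x \<le> 15 * n\<^sup>2 * u"
    using QR(4) \<open>0 < x\<close> by (simp add: pos_divide_le_eq)
  ultimately show ?thesis
    using QR(1,2) unfolding frobenius_norm_eq_norm x_def by blast
qed

end
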